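(* Let $q$ be a primitive $m$th root of $1$ with $m$ odd. The center of $F_q(N)$ is generated by the elements $$\Omega,\qquad z_i^m,\ (z_i^* )^m\quad (i=0,1,\dots,N-1),\qquad (z_{N-1})^a(z_{N-1}^* )^b\quad\text{with } a+b=m,\ a,b\in\{1,2,\dots,m-1\}.$$
   Context: $F_q(N)$ is the associative unital $\mathbb C$-algebra generated by $z_0,\dots,z_{N-1},z_0^*,\dots,z_{N-1}^*$ subject to $z_iz_j=q^{-1}z_jz_i$ for $i<j$; $z_i^*z_j^*=q\,z_j^*z_i^*$ for $i<j$; $z_iz_j^*=q^{-1}z_j^*z_i$ for $i\neq j$; $z_iz_i^*-z_i^*z_i=(q^2-1)\sum_{k>i}z_kz_k^*$. Moreover $\Omega=\sum_{k=0}^{N-1}z_kz_k^*$.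
   Formalization: N ≥ 2 is assumed: for N = 1 the algebra is the commutative polynomial ring in z_0, z_0^*, its own center, and for m ≥ 3 the listed elements (of degree 2 or m) do not generate z_0; for N = 0, z_{N-1} is undefined. *)

theory Defs
  imports
    Complex_Main
    "HOL-Library.Poly_Mapping"
    "HOL-Algebra.QuotRing"
    "HOL-Algebra.Generated_Rings"
begin

section \<open>Free algebras\<close>

text \<open>
  Words are made into an additively written monoid under concatenation, because the
  convolution product on \<^type>\<open>poly_mapping\<close> expects its index monoid in
  additive notation. With this, \<open>'a word \<Rightarrow>\<^sub>0 complex\<close> is the monoid algebra of
  the free monoid on \<open>'a\<close>, that is, the free associative unital complex algebra on \<open>'a\<close>.
\<close>

datatype 'a word = Word (letters: "'a list")

instantiation word :: (type) monoid_add
begin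

definition zero_word :: "'a word" where
  "zero_word = Word []"

definition plus_word :: "'a word \<Rightarrow> 'a word \<Rightarrow> 'a word" where
  "plus_word u v = Word (letters u @ letters v)"

instance
  by standard (auto simp: zero_word_def plus_word_def)

end

definition gen :: "'a \<Rightarrow> ('a word \<Rightarrow>\<^sub>0 complex)" where
  "gen x = Poly_Mapping.single (Word [x]) 1"

definition scal :: "complex \<Rightarrow> ('a word \<Rightarrow>\<^sub>0 complex)" where
  "scal c = Poly_Mapping.single 0 c"

definition free_algebra :: "'a set \<Rightarrow> ('a word \<Rightarrow>\<^sub>0 complex) ring" where
  "free_algebra S =
    \<lparr>carrier = {p. \<forall>w \<in> Poly_Mapping.keys p. set (letters w) \<subseteq> S},
     mult = (*), one = 1, zero = 0, add = (+)\<rparr>"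

lemma ring_free_algebra: "ring (free_algebra S)"
proof (rule ringI)
  show "abelian_group (free_algebra S)"
  proof (rule abelian_groupI)
    fix p assume p: "p \<in> carrier (free_algebra S)"
    then have "- p \<in> carrier (free_algebra S)"
      by (simp add: free_algebra_def)
    then show "\<exists>r\<in>carrier (free_algebra S). r \<oplus>\<^bsub>free_algebra S\<^esub> p = \<zero>\<^bsub>free_algebra S\<^esub>"
      by (intro bexI[of _ "- p"]) (simp_all add: free_algebra_def)
  next
    fix p r assume "p \<in> carrier (free_algebra S)" "r \<in> carrier (free_algebra S)"
    then show "p \<oplus>\<^bsub>free_algebra S\<^esub> r \<in> carrier (free_algebra S)"
      using keys_add[of p r] by (auto simp: free_algebra_def)
  qed (auto simp: free_algebra_def algebra_simps)
  show "Group.monoid (free_algebra S)"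
  proof (rule monoidI)
    fix p r assume "p \<in> carrier (free_algebra S)" "r \<in> carrier (free_algebra S)"
    then show "p \<otimes>\<^bsub>free_algebra S\<^esub> r \<in> carrier (free_algebra S)"
      using keys_mult[of p r] by (fastforce simp: free_algebra_def plus_word_def)
  qed (auto simp: free_algebra_def mult.assoc zero_word_def)
qed (auto simp: free_algebra_def algebra_simps)


section \<open>The algebra \<open>F_q(N)\<close>\<close>

text \<open>\<open>Z i\<close> and \<open>Zs i\<close> are the letters standing for $z_i$ and $z_i^*$.\<close>

datatype letter = Z nat | Zs nat

definition Fq_letters :: "nat \<Rightarrow> letter set" where
  "Fq_letters N = Z ` {..<N} \<union> Zs ` {..<N}"

text \<open>Each defining relation \<open>l = r\<close> is recorded as the element \<open>l - r\<close>.\<close>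

definition Fq_relators :: "complex \<Rightarrow> nat \<Rightarrow> (letter word \<Rightarrow>\<^sub>0 complex) set" where
  "Fq_relators q N =
     {gen (Z i) * gen (Z j) - scal (inverse q) * gen (Z j) * gen (Z i) | i j. i < j \<and> j < N}
   \<union> {gen (Zs i) * gen (Zs j) - scal q * gen (Zs j) * gen (Zs i) | i j. i < j \<and> j < N}
   \<union> {gen (Z i) * gen (Zs j) - scal (inverse q) * gen (Zs j) * gen (Z i)
        | i j. i < N \<and> j < N \<and> i \<noteq> j}
   \<union> {gen (Z i) * gen (Zs i) - gen (Zs i) * gen (Z i)
        - scal (q\<^sup>2 - 1) * (\<Sum>k\<in>{i<..<N}. gen (Z k) * gen (Zs k)) | i. i < N}"

definition Fq_ideal :: "complex \<Rightarrow> nat \<Rightarrow> (letter word \<Rightarrow>\<^sub>0 complex) set" where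
  "Fq_ideal q N = Idl\<^bsub>free_algebra (Fq_letters N)\<^esub> (Fq_relators q N)"

definition Fq :: "complex \<Rightarrow> nat \<Rightarrow> (letter word \<Rightarrow>\<^sub>0 complex) set ring" where
  "Fq q N = free_algebra (Fq_letters N) Quot Fq_ideal q N"

definition Fq_class ::
    "complex \<Rightarrow> nat \<Rightarrow> (letter word \<Rightarrow>\<^sub>0 complex) \<Rightarrow> (letter word \<Rightarrow>\<^sub>0 complex) set" where
  "Fq_class q N p = Fq_ideal q N +>\<^bsub>free_algebra (Fq_letters N)\<^esub> p"

definition z :: "complex \<Rightarrow> nat \<Rightarrow> nat \<Rightarrow> (letter word \<Rightarrow>\<^sub>0 complex) set" where
  "z q N i = Fq_class q N (gen (Z i))"

definition zstar :: "complex \<Rightarrow> nat \<Rightarrow> nat \<Rightarrow> (letter word \<Rightarrow>\<^sub>0 complex) set" where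
  "zstar q N i = Fq_class q N (gen (Zs i))"

definition Omega :: "complex \<Rightarrow> nat \<Rightarrow> (letter word \<Rightarrow>\<^sub>0 complex) set" where
  "Omega q N = (\<Oplus>\<^bsub>Fq q N\<^esub>k\<in>{..<N}. z q N k \<otimes>\<^bsub>Fq q N\<^esub> zstar q N k)"

text \<open>
  The unital complex subalgebra of \<open>F_q(N)\<close> generated by \<open>H\<close> is the subring generated by
  \<open>H\<close> together with the scalars.
\<close>

definition Fq_subalgebra_gen ::
    "complex \<Rightarrow> nat \<Rightarrow> (letter word \<Rightarrow>\<^sub>0 complex) set set
      \<Rightarrow> (letter word \<Rightarrow>\<^sub>0 complex) set set" where
  "Fq_subalgebra_gen q N H = generate_ring (Fq q N) (range (\<lambda>c. Fq_class q N (scal c)) \<union> H)"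

definition ring_center :: "('a, 'b) ring_scheme \<Rightarrow> 'a set" where
  "ring_center R = {x \<in> carrier R. \<forall>y \<in> carrier R. x \<otimes>\<^bsub>R\<^esub> y = y \<otimes>\<^bsub>R\<^esub> x}"

definition primitive_root_of_unity :: "nat \<Rightarrow> complex \<Rightarrow> bool" where
  "primitive_root_of_unity m q \<longleftrightarrow> 0 < m \<and> q ^ m = 1 \<and> (\<forall>k. 0 < k \<and> k < m \<longrightarrow> q ^ k \<noteq> 1)"


section \<open>Well-formedness\<close>

lemma scal_in_carrier: "scal c \<in> carrier (free_algebra S)"
  by (simp add: scal_def free_algebra_def zero_word_def)

lemma gen_in_carrier: "x \<in> S \<Longrightarrow> gen x \<in> carrier (free_algebra S)"
  by (simp add: gen_def free_algebra_def)

lemma free_algebra_closed: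
  shows "\<lbrakk>p \<in> carrier (free_algebra S); r \<in> carrier (free_algebra S)\<rbrakk>
      \<Longrightarrow> p * r \<in> carrier (free_algebra S)"
    and "\<lbrakk>p \<in> carrier (free_algebra S); r \<in> carrier (free_algebra S)\<rbrakk>
      \<Longrightarrow> p - r \<in> carrier (free_algebra S)"
    and "(\<And>k. k \<in> K \<Longrightarrow> f k \<in> carrier (free_algebra S)) \<Longrightarrow> sum f K \<in> carrier (free_algebra S)"
proof -
  interpret ring "free_algebra S" by (rule ring_free_algebra)
  have add: "p + r \<in> carrier (free_algebra S)"
    if "p \<in> carrier (free_algebra S)" "r \<in> carrier (free_algebra S)" for p r
    using a_closed[OF that] by (simp add: free_algebra_def)
  show "p * r \<in> carrier (free_algebra S)"
    if "p \<in> carrier (free_algebra S)" "r \<in> carrier (free_algebra S)"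
    using m_closed[OF that] by (simp add: free_algebra_def)
  show "p - r \<in> carrier (free_algebra S)"
    if "p \<in> carrier (free_algebra S)" "r \<in> carrier (free_algebra S)"
    using add[OF that(1), of "- r"] that(2) by (simp add: free_algebra_def)
  show "sum f K \<in> carrier (free_algebra S)"
    if "\<And>k. k \<in> K \<Longrightarrow> f k \<in> carrier (free_algebra S)"
    using that
  proof (induction K rule: infinite_finite_induct)
    case (insert k K)
    then show ?case by (simp add: add)
  qed (simp_all add: free_algebra_def)
qed

lemma Fq_relators_in_carrier: "Fq_relators q N \<subseteq> carrier (free_algebra (Fq_letters N))"
  unfolding Fq_relators_def
  by (auto intro!: free_algebra_closed gen_in_carrier scal_in_carrier simp: Fq_letters_def)

lemma ideal_Fq_ideal: "ideal (Fq_ideal q N) (free_algebra (Fq_letters N))"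
  unfolding Fq_ideal_def
  by (rule ring.genideal_ideal[OF ring_free_algebra Fq_relators_in_carrier])

lemma ring_Fq: "ring (Fq q N)"
  unfolding Fq_def by (rule ideal.quotient_is_ring[OF ideal_Fq_ideal])

end

(*
  Write w_k for z_k^* and put Om_i = sum_{k >= i} z_k w_k. These elements commute with each other;
  z_j and w_j commute with Om_i for i <= j, and q-commute with it for i > j, with factors q^{-2} and q^2;
  moreover z_j w_j = Om_j - Om_{j+1} and w_j z_j = Om_j - q^2 Om_{j+1}. So F_q(N) is a generalized
  Weyl algebra over the polynomial ring in the Om_i, with basis
  E(n,d) = prod_i Om_i^{n_i} prod_i G_i(d_i), where G_i(d) is z_i^d for d >= 0 and w_i^{-d} for d < 0.
  Linear independence comes from an explicit action on coefficient functions.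

  Let x be central. Commuting with every Om_k forces m | d_k (k < N-1) in each E(n,d) occurring
  in x; the factors G_k(d_k) with k < N-1 are then central, and commuting with z_j (if d_j >= 0)
  or w_j (if d_j <= 0) forces m | 2 sum_{i>j} n_i + |d_{N-1}| for j < N-1. As m is odd, m | n_i for
  0 < i < N-1 and m | 2 n_{N-1} + |d_{N-1}|. Such an E(n,d) is in the subalgebra generated by the
  given elements, because Om_{N-1} = z_{N-1} w_{N-1} and z_i^m w_i^m = Om_i^m - Om_{i+1}^m; the last
  identity is prod_{l<m} (X - q^{-2l} Y) = X^m - Y^m.
*)

theory Submission
  imports Defs "HOL-Computational_Algebra.Polynomial"
begin

section \<open>Preliminaries\<close>

text \<open>The monomials span because their span contains 1 and is stable under left multiplication
  by the generators. Independence is harder, as it needs a model of the quotient. The model is dual: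
  operators on arbitrary functions h(n,d), without finite support, are given by pointwise formulas,
  and x = x E(0,0) is paired with h by evaluating at (0,0) the operator of x applied to h. Delta
  functions then read off coefficients. The conditions on a central x come in two rounds because
  E(n,d) always q-commutes with Om_k, but in general not with z_j: for d_j < 0 it contains a power
  of w_j. Only once m | d_k for k < N-1 is each E(n,d) occurring in x a weight vector for z_j and
  w_j with j < N-1. The sign of d_j decides which of the two is used: the one that lengthens
  G_j(d_j) sends E(n,d) to a multiple of a single basis element. Oddness of m also makes q^{-2} a
  primitive m-th root of unity. For N = 1 the algebra is commutative, and there is no j < N-1 to
  give a condition.\<close>

lemma power_mult_commuting:
  fixes x y :: "'b::monoid_mult"
  assumes "x * y = y * x"
  shows "(x * y) ^ k = x ^ k * y ^ k"
proof (induction k)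
  case (Suc k)
  have "(x * y) ^ Suc k = x * (y * x ^ k) * y ^ k"
    by (simp add: Suc.IH mult.assoc)
  also have "y * x ^ k = x ^ k * y"
    using power_commuting_commutes[OF assms] by simp
  finally show ?case by (simp add: mult.assoc)
qed simp

text \<open>Both sides are monic of degree m and vanish at the m powers of w, which are distinct
  because w has exact order m.\<close>

lemma prod_linear_roots_of_unity:
  fixes w :: complex
  assumes w: "w ^ m = 1" "\<And>k. 0 < k \<Longrightarrow> k < m \<Longrightarrow> w ^ k \<noteq> 1" and "m > 0"
  shows "(\<Prod>l<m. [:- (w ^ l), 1:]) = monom 1 m - 1"
proof (rule poly_eqI_degree_lead_coeff)
  let ?p = "\<Prod>l<m. [:- (w ^ l), 1:]"
  have deg: "degree ?p = m"
    by (subst degree_prod_eq_sum_degree) auto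
  then show "degree ?p \<le> m" by simp
  show "degree (monom 1 m - 1 :: complex poly) \<le> m"
    by (intro degree_diff_le degree_monom_le) auto
  have "coeff ?p m = lead_coeff ?p" using deg by simp
  also have "\<dots> = 1" by (simp add: lead_coeff_prod)
  finally show "coeff ?p m = coeff (monom 1 m - 1) m"
    using \<open>m > 0\<close> by (simp add: coeff_1)
  have "w \<noteq> 0" using w(1) \<open>m > 0\<close> by (auto simp: power_0_left)
  have *: "w ^ i \<noteq> w ^ j" if "i < j" "j < m" for i j
  proof
    assume "w ^ i = w ^ j"
    also have "w ^ j = w ^ i * w ^ (j - i)"
      using that by (simp flip: power_add)
    finally show False
      using w(2)[of "j - i"] that \<open>w \<noteq> 0\<close> by simp
  qed
  have "inj_on (\<lambda>l. w ^ l) {..<m}"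
    by (rule linorder_inj_onI) (use * in auto)
  then show "m \<le> card ((\<lambda>l. w ^ l) ` {..<m})"
    by (simp add: card_image)
  fix x assume "x \<in> (\<lambda>l. w ^ l) ` {..<m}"
  then obtain l where l: "l < m" "x = w ^ l" by auto
  have "x ^ m = (w ^ m) ^ l"
    by (simp add: l(2) mult.commute flip: power_mult)
  then have "x ^ m = 1" by (simp add: w(1))
  moreover have "poly ?p x = 0"
    using l by (auto simp: poly_prod)
  ultimately show "poly ?p x = poly (monom 1 m - 1) x"
    by (simp add: poly_monom)
qed

text \<open>The added word is absent from the rest, so nothing cancels, and a condition on all words
  of the sum passes to both summands.\<close>

lemma poly_mapping_induct [case_names zero single_add]:
  fixes p :: "'k \<Rightarrow>\<^sub>0 'b::monoid_add"
  assumes "P 0" "\<And>w c p. w \<notin> Poly_Mapping.keys p \<Longrightarrow> c \<noteq> 0 \<Longrightarrow> P p \<Longrightarrow> P (Poly_Mapping.single w c + p)"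
  shows "P p"
proof (induction p rule: update_induct)
  case (update p w c)
  have "Poly_Mapping.update w c p = Poly_Mapping.single w c + p"
    using update
    by (intro poly_mapping_eqI)
      (auto simp: Poly_Mapping.lookup_update lookup_add lookup_single when_def in_keys_iff)
  then show ?case
    using update assms(2) by simp
qed (rule assms(1))

definition add_at :: "nat \<Rightarrow> 'b::ab_semigroup_add \<Rightarrow> (nat \<Rightarrow> 'b) \<Rightarrow> nat \<Rightarrow> 'b" where
  "add_at k c f = f(k := f k + c)"

lemma add_at_commute: "add_at k c (add_at l b f) = add_at l b (add_at k c f)"
  by (auto simp: add_at_def fun_eq_iff ac_simps)

lemma add_at_same: "add_at k c (add_at k b f) = add_at k (b + c) f"
  by (auto simp: add_at_def fun_eq_iff ac_simps)

lemma add_at_inject: "add_at k c f = add_at k c g \<longleftrightarrow> f = g"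
  for c :: "'b::cancel_ab_semigroup_add"
proof
  assume *: "add_at k c f = add_at k c g"
  have "f i = g i" for i
    using fun_cong[OF *, of i] by (cases "i = k") (auto simp: add_at_def)
  then show "f = g" by auto
qed simp

lemma add_at_0 [simp]: "add_at k (0 :: 'b::comm_monoid_add) f = f"
  by (auto simp: add_at_def)

lemma add_at_eq: "add_at k c f k = f k + c"
  by (simp add: add_at_def)

lemma add_at_neq: "i \<noteq> k \<Longrightarrow> add_at k c f i = f i"
  by (simp add: add_at_def)

lemma sum_add_at:
  fixes f :: "nat \<Rightarrow> 'b::comm_monoid_add"
  assumes "finite A"
  shows "(\<Sum>i\<in>A. add_at k c f i) = (\<Sum>i\<in>A. f i) + (if k \<in> A then c else 0)"
proof -
  have "(\<Sum>i\<in>A. add_at k c f i) = (\<Sum>i\<in>A. f i + (if i = k then c else 0))"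
    by (rule sum.cong) (auto simp: add_at_def)
  then show ?thesis
    using assms by (simp add: sum.distrib)
qed

lemma sum_int_add_at:
  assumes "finite A"
  shows "(\<Sum>i\<in>A. int (add_at k c f i)) = (\<Sum>i\<in>A. int (f i)) + (if k \<in> A then int c else 0)"
  by (simp add: sum_add_at[OF assms] flip: of_nat_sum)

section \<open>The regular representation in coordinates\<close>

text \<open>These play the role of linear forms on the space with basis E(n,d). Arbitrary functions
  are allowed, so no support condition has to be maintained by the operators.\<close>

type_synonym coeffs = "(nat \<Rightarrow> nat) \<Rightarrow> (nat \<Rightarrow> int) \<Rightarrow> complex"

text \<open>
  The operators below are the transposes of the left multiplications by \<open>\<Omega>\<^sub>k\<close>, \<open>z\<^sub>j\<close> and
  \<open>z\<^sub>j\<^sup>*\<close> on the basis \<open>E n d\<close> introduced later, so products act in reverse order.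
\<close>

definition opOm :: "nat \<Rightarrow> nat \<Rightarrow> coeffs \<Rightarrow> coeffs" where
  "opOm N k h n d = (if k < N then h (add_at k 1 n) d else 0)"

definition opZ :: "complex \<Rightarrow> nat \<Rightarrow> nat \<Rightarrow> coeffs \<Rightarrow> coeffs" where
  "opZ q N j h n d =
    (let \<nu> = (\<Sum>i\<in>{j<..<N}. int (n i)); \<delta> = (\<Sum>i<j. d i); d' = add_at j 1 d in
     if d j \<ge> 0 then q powi \<delta> / (q powi \<nu>)\<^sup>2 * h n d'
     else (opOm N j h n d' - opOm N (Suc j) h n d') / ((q powi \<nu>)\<^sup>2 * q powi \<delta>))"

definition opS :: "complex \<Rightarrow> nat \<Rightarrow> nat \<Rightarrow> coeffs \<Rightarrow> coeffs" where
  "opS q N j h n d =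
    (let \<nu> = (\<Sum>i\<in>{j<..<N}. int (n i)); \<delta> = (\<Sum>i<j. d i); d' = add_at j (-1) d in
     if d j \<le> 0 then (q powi \<nu>)\<^sup>2 * q powi \<delta> * h n d'
     else (q powi \<nu>)\<^sup>2 / q powi \<delta> * (opOm N j h n d' - q\<^sup>2 * opOm N (Suc j) h n d'))"

lemmas op_simps = opZ_def opS_def opOm_def Let_def sum_add_at sum_int_add_at add_at_eq add_at_neq
  add_at_same power_int_add power_int_diff power_mult_distrib

text \<open>Transposes reverse products, so this is the identity for z_j w_j. In the case
  \<open>d j > 0\<close> the q^2 in front of \<open>opOm N (Suc j)\<close> cancels the q^{-2} that
  \<open>opZ\<close> gains when n grows at \<open>Suc j\<close>.\<close>

lemma opS_opZ:
  assumes "q \<noteq> 0" "j < N"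
  shows "opS q N j (opZ q N j h) n d = opOm N j h n d - opOm N (Suc j) h n d"
  using assms
  by (cases "d j \<le> 0"; simp add: op_simps; simp add: field_simps)

lemma opZ_opS:
  assumes "q \<noteq> 0" "j < N"
  shows "opZ q N j (opS q N j h) n d = opOm N j h n d - q\<^sup>2 * opOm N (Suc j) h n d"
  using assms
  by (cases "d j \<ge> 0"; simp add: op_simps; simp add: field_simps)

lemma opZ_opZ:
  assumes "q \<noteq> 0" "i < j" "j < N"
  shows "opZ q N j (opZ q N i h) n d = opZ q N i (opZ q N j h) n d / q"
  using assms
  by (cases "d j \<ge> 0"; cases "d i \<ge> 0"; simp add: op_simps; simp add: field_simps power2_eq_square add_at_commute)

lemma opS_opS:
  assumes "q \<noteq> 0" "i < j" "j < N"
  shows "opS q N j (opS q N i h) n d = q * opS q N i (opS q N j h) n d"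
  using assms
  by (cases "d j \<le> 0"; cases "d i \<le> 0"; simp add: op_simps; simp add: field_simps power2_eq_square add_at_commute)

lemma opS_opZ_less:
  assumes "q \<noteq> 0" "i < j" "j < N"
  shows "opS q N j (opZ q N i h) n d = opZ q N i (opS q N j h) n d / q"
  using assms
  by (cases "d j \<le> 0"; cases "d i \<ge> 0"; simp add: op_simps; simp add: field_simps power2_eq_square add_at_commute)

lemma opS_opZ_greater:
  assumes "q \<noteq> 0" "j < i" "i < N"
  shows "opS q N j (opZ q N i h) n d = opZ q N i (opS q N j h) n d / q"
  using assms
  by (cases "d j \<le> 0"; cases "d i \<ge> 0"; simp add: op_simps; simp add: field_simps power2_eq_square add_at_commute)

text \<open>The sum telescopes and ends at \<open>opOm N N\<close>, which is zero by
  definition.\<close>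

lemma sum_opS_opZ:
  assumes "q \<noteq> 0" "i < N"
  shows "(\<Sum>k\<in>{i<..<N}. opS q N k (opZ q N k h) n d) = opOm N (Suc i) h n d"
proof -
  have "(\<Sum>k\<in>{Suc i..<N}. opOm N (Suc k) h n d - opOm N k h n d) = opOm N N h n d - opOm N (Suc i) h n d"
    by (rule sum_Suc_diff') (use assms in auto)
  moreover have "{i<..<N} = {Suc i..<N}" by auto
  ultimately show ?thesis
    using assms by (simp add: opS_opZ sum_subtractf) (simp add: opOm_def algebra_simps)
qed

lemma opS_opZ_diff:
  assumes "q \<noteq> 0" "i < N"
  shows "opS q N i (opZ q N i h) n d - opZ q N i (opS q N i h) n d =
    (q\<^sup>2 - 1) * (\<Sum>k\<in>{i<..<N}. opS q N k (opZ q N k h) n d)"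
  unfolding sum_opS_opZ[OF assms] using assms by (simp add: opS_opZ opZ_opS algebra_simps)

lemma op_linear:
  "opZ q N j (\<lambda>n d. a * f n d + b * g n d) = (\<lambda>n d. a * opZ q N j f n d + b * opZ q N j g n d)"
  "opS q N j (\<lambda>n d. a * f n d + b * g n d) = (\<lambda>n d. a * opS q N j f n d + b * opS q N j g n d)"
  by (auto simp: fun_eq_iff opZ_def opS_def opOm_def Let_def algebra_simps diff_divide_distrib add_divide_distrib)

section \<open>\<open>q\<close>-commutation and the spanning monomials\<close>

locale q_algebra = vector_space sm
  for sm :: "complex \<Rightarrow> 'a::{ring,monoid_mult} \<Rightarrow> 'a" (infixr "\<cdot>" 75) +
  fixes q :: complex
  assumes q_nonzero: "q \<noteq> 0"
    and sm_mult_left: "(c \<cdot> x) * y = c \<cdot> (x * y)"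
    and sm_mult_right: "x * (c \<cdot> y) = c \<cdot> (x * y)"
begin

text \<open>Integer weights add under products and change sign when the two sides are exchanged; at
  a root of unity only their residues modulo m matter.\<close>

definition qc :: "int \<Rightarrow> 'a \<Rightarrow> 'a \<Rightarrow> bool" where
  "qc k x y \<longleftrightarrow> x * y = q powi k \<cdot> (y * x)"

lemma q_powi_add: "q powi (k + l) = q powi k * q powi l"
  by (simp add: power_int_add q_nonzero)

lemma qc_0_iff: "qc 0 x y \<longleftrightarrow> x * y = y * x"
  by (simp add: qc_def)

lemma qc_one_right [simp]: "qc 0 x 1"
  by (simp add: qc_def)

lemma qc_zero_right [simp]: "qc k x 0"
  by (simp add: qc_def)

lemma qc_add_right: "qc k x y \<Longrightarrow> qc k x y' \<Longrightarrow> qc k x (y + y')"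
  by (simp add: qc_def distrib_left distrib_right scale_right_distrib)

lemma qc_scale_right: "qc k x y \<Longrightarrow> qc k x (c \<cdot> y)"
  by (simp add: qc_def sm_mult_left sm_mult_right mult.commute)

lemma qc_mult_right:
  assumes "qc k x y" "qc l x y'"
  shows "qc (k + l) x (y * y')"
proof -
  have "x * (y * y') = q powi k \<cdot> (y * (x * y'))"
    using assms(1) by (simp add: qc_def sm_mult_left flip: mult.assoc)
  also have "\<dots> = q powi (k + l) \<cdot> (y * y' * x)"
    using assms(2) by (simp add: qc_def sm_mult_right q_powi_add mult.assoc)
  finally show ?thesis by (simp add: qc_def)
qed

lemma qc_sym: "qc k x y \<Longrightarrow> qc (- k) y x"
  by (simp add: qc_def power_int_minus q_nonzero)

lemma qc_sym_iff: "qc k x y \<longleftrightarrow> qc (- k) y x"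
  using qc_sym[of k x y] qc_sym[of "- k" y x] by auto

lemma qc_mult_left:
  assumes "qc k x y" "qc l x' y"
  shows "qc (k + l) (x * x') y"
  using qc_mult_right[OF qc_sym[OF assms(1)] qc_sym[OF assms(2)]] qc_sym_iff[of "k + l"]
  by simp

lemma qc_power_right: "qc k x y \<Longrightarrow> qc (int n * k) x (y ^ n)"
proof (induction n)
  case (Suc n)
  then show ?case
    using qc_mult_right[of k x y "int n * k" "y ^ n"] by (simp add: algebra_simps)
qed simp

lemma qc_power_left: "qc k x y \<Longrightarrow> qc (int n * k) (x ^ n) y"
  using qc_sym_iff[of k x y] qc_sym_iff[of "int n * k" "x ^ n" y] qc_power_right[of "- k" y x n]
  by simp

lemma qc_sum_right: "(\<And>i. i \<in> I \<Longrightarrow> qc k x (f i)) \<Longrightarrow> qc k x (sum f I)"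
  by (induction I rule: infinite_finite_induct) (auto intro: qc_add_right)

section \<open>Ordered products in a noncommutative ring\<close>

fun oprod :: "(nat \<Rightarrow> 'a) \<Rightarrow> nat \<Rightarrow> 'a" where
  "oprod f 0 = 1"
| "oprod f (Suc k) = oprod f k * f k"

lemma oprod_cong: "(\<And>i. i < k \<Longrightarrow> f i = g i) \<Longrightarrow> oprod f k = oprod g k"
  by (induction k) auto

lemma oprod_upd_ge: "k \<le> j \<Longrightarrow> oprod (\<lambda>i. if i = j then c else f i) k = oprod f k"
  by (rule oprod_cong) auto

lemma qc_oprod: "(\<And>i. i < k \<Longrightarrow> qc (w i) x (f i)) \<Longrightarrow> qc (\<Sum>i<k. w i) x (oprod f k)"
  by (induction k) (auto intro: qc_mult_right)

text \<open>The factor x travels from the left to place j, and each factor crossed contributes its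
  weight. Factors beyond j are not met, so nothing is required of them.\<close>

lemma mult_oprod:
  assumes "j < k" "\<And>i. i < j \<Longrightarrow> qc (w i) x (f i)"
  shows "x * oprod f k = q powi (\<Sum>i<j. w i) \<cdot> oprod (f(j := x * f j)) k"
  using assms
proof (induction k)
  case (Suc k)
  have "x * oprod f (Suc k) = (x * oprod f k) * f k"
    by (simp add: mult.assoc)
  show ?case
  proof (cases "j = k")
    case True
    have "x * oprod f k = q powi (\<Sum>i<k. w i) \<cdot> (oprod f k * x)"
      using qc_oprod[of k w x f] Suc.prems True by (simp add: qc_def)
    then show ?thesis
      using True by (simp add: fun_upd_def oprod_upd_ge sm_mult_left mult.assoc flip: mult.assoc[of x])
  next
    case False
    then show ?thesis
      using Suc by (simp add: sm_mult_left flip: mult.assoc)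
  qed
qed simp

lemma oprod_upd_diff:
  "j < k \<Longrightarrow> oprod (f(j := a - b)) k = oprod (f(j := a)) k - oprod (f(j := b)) k"
proof (induction k)
  case (Suc k)
  then show ?case
    by (cases "j = k")
      (auto simp: fun_upd_def oprod_upd_ge left_diff_distrib right_diff_distrib)
qed simp

lemma oprod_upd_scale:
  "j < k \<Longrightarrow> oprod (f(j := c \<cdot> a)) k = c \<cdot> oprod (f(j := a)) k"
proof (induction k)
  case (Suc k)
  then show ?case
    by (cases "j = k") (auto simp: fun_upd_def oprod_upd_ge sm_mult_left sm_mult_right)
qed simp

end

text \<open>Only the relations are assumed, not that the elements generate or that no further
  relations hold; the spanning argument and the commutation rules are valid in every such
  algebra.\<close>

locale q_sphere = q_algebra sm q
  for sm :: "complex \<Rightarrow> 'a::{ring,monoid_mult} \<Rightarrow> 'a" (infixr "\<cdot>" 75) and q :: complex +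
  fixes N :: nat and Z S :: "nat \<Rightarrow> 'a"
  assumes Z_Z: "\<And>i j. i < j \<Longrightarrow> j < N \<Longrightarrow> qc (-1) (Z i) (Z j)"
    and S_S: "\<And>i j. i < j \<Longrightarrow> j < N \<Longrightarrow> qc 1 (S i) (S j)"
    and Z_S: "\<And>i j. i < N \<Longrightarrow> j < N \<Longrightarrow> i \<noteq> j \<Longrightarrow> qc (-1) (Z i) (S j)"
    and Z_S_same: "\<And>i. i < N \<Longrightarrow> Z i * S i - S i * Z i = (q\<^sup>2 - 1) \<cdot> (\<Sum>k\<in>{i<..<N}. Z k * S k)"
begin

section \<open>The commuting elements Om_i\<close>

definition Om :: "nat \<Rightarrow> 'a" where
  "Om i = (\<Sum>k\<in>{i..<N}. Z k * S k)"

lemma Om_N [simp]: "Om N = 0"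
  by (simp add: Om_def)

lemma Om_rec: "i < N \<Longrightarrow> Om i = Z i * S i + Om (Suc i)"
  by (simp add: Om_def sum.atLeast_Suc_lessThan)

lemma Z_mult_S: "i < N \<Longrightarrow> Z i * S i = Om i - Om (Suc i)"
  by (simp add: Om_rec)

lemma S_mult_Z: "i < N \<Longrightarrow> S i * Z i = Om i - q\<^sup>2 \<cdot> Om (Suc i)"
proof -
  assume "i < N"
  moreover have "{i<..<N} = {Suc i..<N}" by auto
  ultimately have "Z i * S i - S i * Z i = (q\<^sup>2 - 1) \<cdot> Om (Suc i)"
    using Z_S_same[of i] by (simp add: Om_def)
  then show ?thesis
    using \<open>i < N\<close> by (simp add: Om_rec algebra_simps)
qed

lemma Z_Z': "i < j \<Longrightarrow> j < N \<Longrightarrow> qc 1 (Z j) (Z i)"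
  using qc_sym[OF Z_Z] by simp
lemma S_S': "i < j \<Longrightarrow> j < N \<Longrightarrow> qc (-1) (S j) (S i)"
  using qc_sym[OF S_S] by simp
lemma S_Z: "i < N \<Longrightarrow> j < N \<Longrightarrow> i \<noteq> j \<Longrightarrow> qc 1 (S i) (Z j)"
  using qc_sym[OF Z_S] by simp

lemma Z_Om_gt: assumes "j < i" "i \<le> N" shows "qc (-2) (Z j) (Om i)"
  unfolding Om_def
proof (rule qc_sum_right)
  fix k assume "k \<in> {i..<N}"
  then show "qc (-2) (Z j) (Z k * S k)"
    using qc_mult_right[of "-1" "Z j" "Z k" "-1" "S k"] assms Z_Z[of j k] Z_S[of j k] by simp
qed

lemma S_Om_gt: assumes "j < i" "i \<le> N" shows "qc 2 (S j) (Om i)"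
  unfolding Om_def
proof (rule qc_sum_right)
  fix k assume "k \<in> {i..<N}"
  then show "qc 2 (S j) (Z k * S k)"
    using qc_mult_right[of "1" "S j" "Z k" "1" "S k"] assms S_S[of j k] S_Z[of j k] by simp
qed

text \<open>For i = j, substituting Om_j = w_j z_j + q^2 Om_{j+1} gives z_j Om_j = z_j w_j z_j + q^2
  z_j Om_{j+1}, and the weight -2 of Om_{j+1} absorbs the q^2. For i < j the weights 1 and -1 of z_i
  and w_i cancel.\<close>

lemma Z_Om_le: assumes "i \<le> j" "j < N" shows "Z j * Om i = Om i * Z j"
  using assms
proof (induction i rule: inc_induct)
  case base
  have *: "Z j * Om (Suc j) = q powi (-2) \<cdot> (Om (Suc j) * Z j)"
    using Z_Om_gt[of j "Suc j"] assms by (simp add: qc_def)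
  have "Om j = S j * Z j + q\<^sup>2 \<cdot> Om (Suc j)"
    using S_mult_Z[OF assms(2)] by simp
  then have "Z j * Om j = Z j * S j * Z j + Om (Suc j) * Z j"
    by (simp add: distrib_left sm_mult_right * mult.assoc power_int_minus q_nonzero)
  then show ?case
    using assms by (simp add: Om_rec distrib_right)
next
  case (step i)
  have "qc 0 (Z j) (Z i * S i)"
    using qc_mult_right[of 1 "Z j" "Z i" "-1" "S i"] Z_Z'[of i j] Z_S[of j i] step by simp
  then show ?case
    using step by (simp add: Om_rec qc_def distrib_left distrib_right)
qed

lemma S_Om_le: assumes "i \<le> j" "j < N" shows "S j * Om i = Om i * S j"
  using assms
proof (induction i rule: inc_induct)
  case base
  have *: "S j * Om (Suc j) = q\<^sup>2 \<cdot> (Om (Suc j) * S j)"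
    using S_Om_gt[of j "Suc j"] assms by (simp add: qc_def)
  have "Om j * S j = S j * Z j * S j + q\<^sup>2 \<cdot> (Om (Suc j) * S j)"
    using S_mult_Z[OF assms(2)] by (simp add: left_diff_distrib sm_mult_left)
  then show ?case
    using assms * by (simp add: Om_rec distrib_left mult.assoc)
next
  case (step i)
  have "qc 0 (S j) (Z i * S i)"
    using qc_mult_right[of 1 "S j" "Z i" "-1" "S i"] S_S'[of i j] S_Z[of j i] step by simp
  then show ?case
    using step by (simp add: Om_rec qc_def distrib_left distrib_right)
qed

lemma qc_Z_Om: "i < N \<Longrightarrow> j < N \<Longrightarrow> qc (if j < i then -2 else 0) (Z j) (Om i)"
  using Z_Om_gt Z_Om_le by (auto simp: qc_0_iff)

lemma qc_S_Om: "i < N \<Longrightarrow> j < N \<Longrightarrow> qc (if j < i then 2 else 0) (S j) (Om i)"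
  using S_Om_gt S_Om_le by (auto simp: qc_0_iff)

text \<open>Each z_k w_k commutes with Om_j, since the weights of z_k and w_k against Om_j are
  opposite or both zero.\<close>

lemma Om_commute: "i < N \<Longrightarrow> j < N \<Longrightarrow> Om i * Om j = Om j * Om i"
proof -
  assume "i < N" "j < N"
  have "qc 0 (Om j) (Om i)"
    unfolding Om_def[of i]
  proof (rule qc_sum_right)
    fix k assume "k \<in> {i..<N}"
    then have "qc 0 (Z k * S k) (Om j)"
      using qc_mult_left[OF qc_Z_Om[of j k] qc_S_Om[of j k]] \<open>j < N\<close> by (auto split: if_splits)
    then show "qc 0 (Om j) (Z k * S k)"
      by (simp add: qc_0_iff)
  qed
  then show ?thesis by (simp add: qc_0_iff)
qed

section \<open>Signed powers and the monomials E(n,d)\<close>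

definition G :: "nat \<Rightarrow> int \<Rightarrow> 'a" where
  "G i d = (if d \<ge> 0 then Z i ^ nat d else S i ^ nat (- d))"

lemma qc_G_right:
  assumes "qc k x (Z i)" "qc l x (S i)"
  shows "qc (if d \<ge> 0 then d * k else - d * l) x (G i d)"
proof (cases "d \<ge> 0")
  case True
  then show ?thesis
    using qc_power_right[OF assms(1), of "nat d"] by (simp add: G_def)
next
  case False
  then show ?thesis
    using qc_power_right[OF assms(2), of "nat (- d)"] by (simp add: G_def)
qed

lemma qc_Z_G_lt: "i < j \<Longrightarrow> j < N \<Longrightarrow> qc d (Z j) (G i d)"
  using qc_G_right[of 1 "Z j" i "-1" d, OF Z_Z' Z_S] by (auto split: if_splits)

lemma qc_S_G_lt: "i < j \<Longrightarrow> j < N \<Longrightarrow> qc d (S j) (G i d)"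
  using qc_G_right[of 1 "S j" i "-1" d, OF S_Z S_S'] by (auto split: if_splits)

text \<open>Against z_j with j < i, both z_i and w_i have weight -1, so only the absolute value of d
  enters; for i < j the weights are opposite and d itself enters. This is the origin of the absolute
  value in \<open>central_index\<close>.\<close>

lemma qc_Z_G_gt: "j < i \<Longrightarrow> i < N \<Longrightarrow> qc (- \<bar>d\<bar>) (Z j) (G i d)"
  using qc_G_right[of "-1" "Z j" i "-1" d, OF Z_Z Z_S] by (auto split: if_splits)

lemma qc_S_G_gt: "j < i \<Longrightarrow> i < N \<Longrightarrow> qc \<bar>d\<bar> (S j) (G i d)"
  using qc_G_right[of 1 "S j" i 1 d, OF S_Z S_S] by (auto split: if_splits)

lemma qc_Om_G: "i < N \<Longrightarrow> k < N \<Longrightarrow> qc (if i < k then 2 * d else 0) (Om k) (G i d)"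
  using qc_G_right[OF qc_sym[OF qc_Z_Om[of k i]] qc_sym[OF qc_S_Om[of k i]], of d]
  by (auto split: if_splits simp: mult.commute)

lemma Z_mult_G_nonneg: "d \<ge> 0 \<Longrightarrow> Z j * G j d = G j (d + 1)"
  by (simp add: G_def nat_add_distrib)

lemma S_mult_G_nonpos: "d \<le> 0 \<Longrightarrow> S j * G j d = G j (d - 1)"
proof -
  assume "d \<le> 0"
  then obtain n where "d = - int n"
    by (metis minus_minus nonneg_int_cases neg_0_le_iff_le)
  then show ?thesis
    by (cases n) (auto simp: G_def nat_add_distrib)
qed

text \<open>One factor w_j is split off on the left and completes the product z_j w_j.\<close>

lemma Z_mult_G_neg: "d < 0 \<Longrightarrow> j < N \<Longrightarrow> Z j * G j d = Om j * G j (d + 1) - Om (Suc j) * G j (d + 1)"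
proof -
  assume "d < 0" "j < N"
  have "Z j * G j d = (Z j * S j) * G j (d + 1)"
    using S_mult_G_nonpos[of "d + 1" j] \<open>d < 0\<close> by (simp add: mult.assoc)
  then show ?thesis
    using \<open>j < N\<close> by (simp add: Z_mult_S left_diff_distrib)
qed

lemma S_mult_G_pos: "d > 0 \<Longrightarrow> j < N \<Longrightarrow> S j * G j d = Om j * G j (d - 1) - q\<^sup>2 \<cdot> (Om (Suc j) * G j (d - 1))"
proof -
  assume "d > 0" "j < N"
  have "S j * G j d = (S j * Z j) * G j (d - 1)"
    using Z_mult_G_nonneg[of "d - 1" j] \<open>d > 0\<close> by (simp add: mult.assoc)
  then show ?thesis
    using \<open>j < N\<close> by (simp add: S_mult_Z left_diff_distrib sm_mult_left)
qed

definition OmP :: "(nat \<Rightarrow> nat) \<Rightarrow> 'a" where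
  "OmP n = oprod (\<lambda>i. Om i ^ n i) N"

definition GP :: "(nat \<Rightarrow> int) \<Rightarrow> 'a" where
  "GP d = oprod (\<lambda>i. G i (d i)) N"

definition E :: "(nat \<Rightarrow> nat) \<Rightarrow> (nat \<Rightarrow> int) \<Rightarrow> 'a" where
  "E n d = OmP n * GP d"

text \<open>The factors \<open>Om i\<close> with a nonzero weight against z_j are those with i > j,
  hence \<nu>; the G-factors crossed on the way to place j are those with i < j, hence \<delta>. The
  same two numbers appear in \<open>opZ\<close> and \<open>opS\<close>.\<close>

abbreviation \<nu> :: "nat \<Rightarrow> (nat \<Rightarrow> nat) \<Rightarrow> int" where
  "\<nu> j n \<equiv> (\<Sum>i\<in>{j<..<N}. int (n i))"

abbreviation \<delta> :: "nat \<Rightarrow> (nat \<Rightarrow> int) \<Rightarrow> int" where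
  "\<delta> j d \<equiv> (\<Sum>i<j. d i)"

lemma sum_above: "(\<Sum>i<N. if j < i then f i else 0) = (\<Sum>i\<in>{j<..<N}. f i)"
  for f :: "nat \<Rightarrow> int"
  by (rule sum.mono_neutral_cong_right) auto

lemma qc_Z_OmP: "j < N \<Longrightarrow> qc (- 2 * \<nu> j n) (Z j) (OmP n)"
proof -
  assume "j < N"
  have "qc (\<Sum>i<N. int (n i) * (if j < i then -2 else 0)) (Z j) (OmP n)"
    unfolding OmP_def by (rule qc_oprod) (use qc_power_right[OF qc_Z_Om] \<open>j < N\<close> in blast)
  moreover have "(\<Sum>i<N. int (n i) * (if j < i then -2 else 0)) = - 2 * \<nu> j n"
    by (simp add: if_distrib sum_above sum_distrib_left mult.commute sum_negf[symmetric] cong: if_cong)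
  ultimately show ?thesis by simp
qed

lemma qc_S_OmP: "j < N \<Longrightarrow> qc (2 * \<nu> j n) (S j) (OmP n)"
proof -
  assume "j < N"
  have "qc (\<Sum>i<N. int (n i) * (if j < i then 2 else 0)) (S j) (OmP n)"
    unfolding OmP_def by (rule qc_oprod) (use qc_power_right[OF qc_S_Om] \<open>j < N\<close> in blast)
  moreover have "(\<Sum>i<N. int (n i) * (if j < i then 2 else 0)) = 2 * \<nu> j n"
    by (simp add: if_distrib sum_above sum_distrib_left mult.commute cong: if_cong)
  ultimately show ?thesis by simp
qed

lemma Om_mult_OmP: "k < N \<Longrightarrow> Om k * OmP n = OmP (n(k := n k + 1))"
proof -
  assume "k < N"
  then have "Om k * OmP n = oprod ((\<lambda>i. Om i ^ n i)(k := Om k * Om k ^ n k)) N"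
    unfolding OmP_def
    by (subst mult_oprod[where w = "\<lambda>_. 0" and j = k])
       (auto simp: qc_0_iff Om_commute power_commuting_commutes[OF Om_commute])
  also have "\<dots> = OmP (n(k := n k + 1))"
    unfolding OmP_def by (rule oprod_cong) auto
  finally show ?thesis .
qed

lemma OmP_mult_Om: "k < N \<Longrightarrow> OmP n * Om k = Om k * OmP n"
proof -
  assume k: "k < N"
  have "qc (\<Sum>i<N. 0) (Om k) (OmP n)"
    unfolding OmP_def using k
    by (intro qc_oprod) (auto simp: qc_0_iff Om_commute power_commuting_commutes[OF Om_commute])
  then show ?thesis by (simp add: qc_0_iff)
qed

lemma Om_mult_E: "k < N \<Longrightarrow> Om k * E n d = E (add_at k 1 n) d"
  by (simp add: add_at_def E_def Om_mult_OmP flip: mult.assoc)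

text \<open>An \<open>Om k\<close> created at place j returns to the front across the factors with i
  < j \<le> k, each of weight \<open>2 * d i\<close>. Together with the exponent
  \<open>\<delta> j d\<close> spent on carrying z_j or w_j to place j, this leaves
  \<open>- \<delta> j d\<close>. For k = N both sides vanish.\<close>

lemma oprod_Om_G:
  assumes "j < N" "j \<le> k" "k \<le> Suc j"
  shows "oprod ((\<lambda>i. G i (d i))(j := Om k * G j c)) N = q powi (- 2 * \<delta> j d) \<cdot> (Om k * GP (d(j := c)))"
proof (cases "k = N")
  case True
  have "oprod ((\<lambda>i. G i (d i))(j := 0)) N = 0"
    using oprod_upd_diff[OF assms(1), of "\<lambda>i. G i (d i)" 0 0] by simp
  then show ?thesis
    using True by simp
next
  case False
  have *: "(\<lambda>i. G i ((d(j := c)) i))(j := Om k * G j ((d(j := c)) j)) = (\<lambda>i. G i (d i))(j := Om k * G j c)"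
    by auto
  have "Om k * GP (d(j := c)) = q powi (\<Sum>i<j. 2 * d i) \<cdot>
      oprod ((\<lambda>i. G i ((d(j := c)) i))(j := Om k * G j ((d(j := c)) j))) N"
    unfolding GP_def
  proof (rule mult_oprod)
    fix i assume i: "i < j"
    have "i < N" "k < N" "i < k"
      using i False assms by auto
    with qc_Om_G[of i k "d i"] i show "qc (2 * d i) (Om k) (G i ((d(j := c)) i))"
      by simp
  qed (use assms in auto)
  then show ?thesis
    unfolding * by (simp add: sum_distrib_left[symmetric] power_int_minus q_nonzero)
qed

lemma mult_GP:
  assumes "j < N" "\<And>i. i < j \<Longrightarrow> qc (d i) x (G i (d i))"
  shows "x * GP d = q powi \<delta> j d \<cdot> oprod ((\<lambda>i. G i (d i))(j := x * G j (d j))) N"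
  unfolding GP_def by (rule mult_oprod) (use assms in auto)

lemma oprod_G_upd: "oprod ((\<lambda>i. G i (d i))(j := G j c)) N = GP (d(j := c))"
  unfolding GP_def by (rule oprod_cong) auto

lemma Z_mult_GP_nonneg: "j < N \<Longrightarrow> d j \<ge> 0 \<Longrightarrow> Z j * GP d = q powi \<delta> j d \<cdot> GP (d(j := d j + 1))"
  by (simp add: mult_GP qc_Z_G_lt Z_mult_G_nonneg oprod_G_upd)

lemma S_mult_GP_nonpos: "j < N \<Longrightarrow> d j \<le> 0 \<Longrightarrow> S j * GP d = q powi \<delta> j d \<cdot> GP (d(j := d j - 1))"
  by (simp add: mult_GP qc_S_G_lt S_mult_G_nonpos oprod_G_upd)

lemma Z_mult_GP_neg:
  "j < N \<Longrightarrow> d j < 0 \<Longrightarrow> Z j * GP d = q powi (- \<delta> j d) \<cdot> ((Om j - Om (Suc j)) * GP (d(j := d j + 1)))"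
  by (simp add: mult_GP qc_Z_G_lt Z_mult_G_neg oprod_upd_diff oprod_Om_G left_diff_distrib
      flip: scale_right_diff_distrib q_powi_add)

lemma S_mult_GP_pos:
  "j < N \<Longrightarrow> d j > 0 \<Longrightarrow> S j * GP d = q powi (- \<delta> j d) \<cdot> ((Om j - q\<^sup>2 \<cdot> Om (Suc j)) * GP (d(j := d j - 1)))"
  by (simp add: mult_GP qc_S_G_lt S_mult_G_pos oprod_upd_diff oprod_upd_scale oprod_Om_G left_diff_distrib sm_mult_left
      scale_right_diff_distrib scale_left_commute[of "q\<^sup>2"] flip: q_powi_add)

lemma Z_mult_E: "j < N \<Longrightarrow> Z j * E n d = q powi (- 2 * \<nu> j n) \<cdot> (OmP n * (Z j * GP d))"
  using qc_Z_OmP[of j n] by (simp add: E_def qc_def sm_mult_left flip: mult.assoc)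

lemma S_mult_E: "j < N \<Longrightarrow> S j * E n d = q powi (2 * \<nu> j n) \<cdot> (OmP n * (S j * GP d))"
  using qc_S_OmP[of j n] by (simp add: E_def qc_def sm_mult_left flip: mult.assoc)

lemma OmP_Om_GP: "OmP n * (Om k * GP d) = Om k * E n d" if "k < N"
  using that by (simp add: E_def OmP_mult_Om flip: mult.assoc)

lemma OmP_Om_GP': "OmP n * (Om k * GP d) = Om k * E n d" if "k \<le> N"
  using that OmP_Om_GP[of k n d] by (cases "k = N") auto

lemma Z_mult_E_nonneg:
  "j < N \<Longrightarrow> d j \<ge> 0 \<Longrightarrow> Z j * E n d = q powi (- 2 * \<nu> j n + \<delta> j d) \<cdot> E n (add_at j 1 d)"
  unfolding q_powi_add by (simp add: add_at_def Z_mult_E Z_mult_GP_nonneg sm_mult_right flip: E_def)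

lemma S_mult_E_nonpos:
  "j < N \<Longrightarrow> d j \<le> 0 \<Longrightarrow> S j * E n d = q powi (2 * \<nu> j n + \<delta> j d) \<cdot> E n (add_at j (-1) d)"
  unfolding q_powi_add by (simp add: add_at_def S_mult_E S_mult_GP_nonpos sm_mult_right flip: E_def)

lemma Z_mult_E_neg:
  "j < N \<Longrightarrow> d j < 0 \<Longrightarrow> Z j * E n d =
    q powi (- 2 * \<nu> j n - \<delta> j d) \<cdot> ((Om j - Om (Suc j)) * E n (add_at j 1 d))"
  unfolding diff_conv_add_uminus[of "- 2 * \<nu> j n"] q_powi_add
  by (simp add: add_at_def Z_mult_E Z_mult_GP_neg sm_mult_right left_diff_distrib right_diff_distrib OmP_Om_GP')

lemma S_mult_E_pos:
  "j < N \<Longrightarrow> d j > 0 \<Longrightarrow> S j * E n d =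
    q powi (2 * \<nu> j n - \<delta> j d) \<cdot> ((Om j - q\<^sup>2 \<cdot> Om (Suc j)) * E n (add_at j (-1) d))"
  unfolding diff_conv_add_uminus[of "2 * \<nu> j n"] q_powi_add
  by (simp add: add_at_def S_mult_E S_mult_GP_pos sm_mult_left sm_mult_right left_diff_distrib right_diff_distrib OmP_Om_GP')

end

section \<open>Central elements and the span of the monomials\<close>

context q_sphere
begin

definition central :: "'a \<Rightarrow> bool" where
  "central x \<longleftrightarrow> (\<forall>i<N. qc 0 (Z i) x \<and> qc 0 (S i) x)"

lemma central_1: "central 1"
  by (simp add: central_def)

lemma central_mult: "central x \<Longrightarrow> central y \<Longrightarrow> central (x * y)"
  using qc_mult_right[of 0 _ x 0 y] by (simp add: central_def)

lemma central_power: "central x \<Longrightarrow> central (x ^ n)"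
  by (induction n) (auto simp: central_1 central_mult)

lemma central_oprod: "(\<And>i. i < k \<Longrightarrow> central (f i)) \<Longrightarrow> central (oprod f k)"
  by (induction k) (auto simp: central_1 central_mult)

lemma central_Om0: "N > 0 \<Longrightarrow> central (Om 0)"
  using qc_Z_Om[of 0] qc_S_Om[of 0] by (simp add: central_def)

definition basis_span :: "'a set" where
  "basis_span = span (range (case_prod E))"

lemma E_in_basis_span: "E n d \<in> basis_span"
  unfolding basis_span_def by (rule span_base) auto

lemma mult_in_basis_span:
  assumes "\<And>n d. x * E n d \<in> basis_span" "y \<in> basis_span"
  shows "x * y \<in> basis_span"
  using assms(2) unfolding basis_span_def
proof (induction rule: span_induct)
  case base
  show ?case
    using span_add span_scale span_zero
    by (auto simp: subspace_def distrib_left sm_mult_right)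
next
  case (step y)
  then show ?case using assms(1) by (auto simp: basis_span_def)
qed

lemma basis_span_closed:
  "0 \<in> basis_span"
  "x \<in> basis_span \<Longrightarrow> y \<in> basis_span \<Longrightarrow> x + y \<in> basis_span"
  "x \<in> basis_span \<Longrightarrow> y \<in> basis_span \<Longrightarrow> x - y \<in> basis_span"
  "x \<in> basis_span \<Longrightarrow> c \<cdot> x \<in> basis_span"
  unfolding basis_span_def by (auto intro: span_zero span_add span_diff span_scale)

lemma Om_mult_basis_span: "k \<le> N \<Longrightarrow> y \<in> basis_span \<Longrightarrow> Om k * y \<in> basis_span"
  by (rule mult_in_basis_span) (auto simp: Om_mult_E E_in_basis_span le_less basis_span_closed)

lemma Z_mult_basis_span:
  assumes "j < N" "y \<in> basis_span"
  shows "Z j * y \<in> basis_span"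
proof (rule mult_in_basis_span)
  fix n d
  show "Z j * E n d \<in> basis_span"
  proof (cases "d j \<ge> 0")
    case True
    then show ?thesis
      using assms by (simp only: Z_mult_E_nonneg basis_span_closed E_in_basis_span)
  next
    case False
    then have "d j < 0" by simp
    show ?thesis
      unfolding Z_mult_E_neg[of j d, OF assms(1) \<open>d j < 0\<close>] left_diff_distrib
      using assms(1) by (intro basis_span_closed Om_mult_basis_span E_in_basis_span) auto
  qed
qed fact

lemma S_mult_basis_span:
  assumes "j < N" "y \<in> basis_span"
  shows "S j * y \<in> basis_span"
proof (rule mult_in_basis_span)
  fix n d
  show "S j * E n d \<in> basis_span"
  proof (cases "d j \<le> 0")
    case True
    then show ?thesis
      using assms by (simp only: S_mult_E_nonpos basis_span_closed E_in_basis_span)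
  next
    case False
    then have "d j > 0" by simp
    show ?thesis
      unfolding S_mult_E_pos[of j d, OF assms(1) \<open>d j > 0\<close>] left_diff_distrib sm_mult_left
      using assms(1) by (intro basis_span_closed Om_mult_basis_span E_in_basis_span) auto
  qed
qed fact

lemma E_0: "E (\<lambda>_. 0) (\<lambda>_. 0) = 1"
proof -
  have "oprod (\<lambda>_. 1) k = 1" for k by (induction k) auto
  then show ?thesis by (simp add: E_def OmP_def GP_def G_def)
qed

lemma one_in_basis_span: "1 \<in> basis_span"
  using E_in_basis_span[of "\<lambda>_. 0" "\<lambda>_. 0"] by (simp add: E_0)

lemma E_cong: "(\<And>i. i < N \<Longrightarrow> n i = n' i) \<Longrightarrow> (\<And>i. i < N \<Longrightarrow> d i = d' i) \<Longrightarrow> E n d = E n' d'"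
  unfolding E_def OmP_def GP_def by (intro arg_cong2[of _ _ _ _ "(*)"] oprod_cong) auto

text \<open>\<open>E\<close> ignores the values at N and beyond; without this normalization one
  monomial would have many indices and could not be independent of itself under another
  name.\<close>

definition supported :: "((nat \<Rightarrow> nat) \<times> (nat \<Rightarrow> int)) set" where
  "supported = {(n, d). \<forall>i\<ge>N. n i = 0 \<and> d i = 0}"

lemma range_E: "range (case_prod E) = case_prod E ` supported"
proof -
  have "E n d \<in> case_prod E ` supported" for n d
  proof (rule image_eqI)
    let ?n = "\<lambda>i. if i < N then n i else 0" and ?d = "\<lambda>i. if i < N then d i else 0"
    show "E n d = case_prod E (?n, ?d)"
      by (simp, rule E_cong) auto
    show "(?n, ?d) \<in> supported" by (auto simp: supported_def)
  qed
  then show ?thesis by auto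
qed

lemma basis_span_expansion:
  assumes "Y \<in> basis_span"
  obtains T c where "finite T" "T \<subseteq> supported" "\<And>s. s \<in> T \<Longrightarrow> c s \<noteq> 0" "Y = (\<Sum>s\<in>T. c s \<cdot> case_prod E s)"
proof -
  obtain t r where t: "finite t" "t \<subseteq> case_prod E ` supported" "Y = (\<Sum>a\<in>t. r a \<cdot> a)"
    using assms unfolding basis_span_def range_E span_explicit by blast
  \<comment> \<open>Injectivity of \<open>E\<close> on \<open>supported\<close> is not known in this
    locale, so one index is chosen for each vector of the combination.\<close>
  then obtain T where T: "T \<subseteq> supported" "inj_on (case_prod E) T" "t = case_prod E ` T"
    using t(2)[unfolded subset_image_inj] by auto
  have "finite T"
    using T(2,3) t(1) by (simp add: finite_image_iff)
  let ?c = "\<lambda>s. r (case_prod E s)"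
  have "Y = (\<Sum>s\<in>T. ?c s \<cdot> case_prod E s)"
    using T t by (simp add: sum.reindex)
  also have "\<dots> = (\<Sum>s\<in>{s\<in>T. ?c s \<noteq> 0}. ?c s \<cdot> case_prod E s)"
    using \<open>finite T\<close> by (intro sum.mono_neutral_right) auto
  finally show ?thesis
    using T(1) \<open>finite T\<close> by (intro that[of "{s\<in>T. ?c s \<noteq> 0}" ?c]) auto
qed

lemma qc_Om_GP: "k < N \<Longrightarrow> qc (2 * \<delta> k d) (Om k) (GP d)"
proof -
  assume k: "k < N"
  have "qc (\<Sum>i<N. if i < k then 2 * d i else 0) (Om k) (GP d)"
    unfolding GP_def using k by (intro qc_oprod qc_Om_G)
  moreover have "(\<Sum>i<N. if i < k then 2 * d i else 0) = (\<Sum>i<k. 2 * d i)"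
    using k by (intro sum.mono_neutral_cong_right) auto
  ultimately show ?thesis by (simp add: sum_distrib_left)
qed

lemma qc_Om_E: "k < N \<Longrightarrow> qc (2 * \<delta> k d) (Om k) (E n d)"
  using qc_mult_right[of 0 "Om k" "OmP n" "2 * \<delta> k d" "GP d"] qc_Om_GP[of k d] OmP_mult_Om[of k n]
  by (simp add: E_def qc_0_iff)

end

text \<open>\<open>K x h\<close> is the operator of x applied to h and evaluated at (0,0), that is,
  the pairing of x = x E(0,0) with h. Hence the leftmost factor of a product is the first to act on
  h.\<close>

locale q_sphere_functional = q_sphere sm q N Z S
  for sm :: "complex \<Rightarrow> 'a::{ring,monoid_mult} \<Rightarrow> 'a" (infixr "\<cdot>" 75) and q N Z S +
  fixes K :: "'a \<Rightarrow> coeffs \<Rightarrow> complex"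
  assumes K_add: "K (x + y) h = K x h + K y h"
    and K_scale: "K (c \<cdot> x) h = c * K x h"
    and K_add_right: "K x (\<lambda>n d. f n d + g n d) = K x f + K x g"
    and K_Z: "j < N \<Longrightarrow> K (Z j * x) h = K x (opZ q N j h)"
    and K_S: "j < N \<Longrightarrow> K (S j * x) h = K x (opS q N j h)"
    and K_1: "K 1 h = h (\<lambda>_. 0) (\<lambda>_. 0)"
begin

lemma K_0: "K 0 h = 0"
  using K_scale[of 0 0 h] by simp

lemma K_sum: "K (\<Sum>i\<in>I. f i) h = (\<Sum>i\<in>I. K (f i) h)"
  by (induction I rule: infinite_finite_induct) (auto simp: K_0 K_add)

lemma K_Om: "k \<le> N \<Longrightarrow> K (Om k * x) h = K x (opOm N k h)"
proof (induction k rule: inc_induct)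
  case base
  have "K x (\<lambda>_ _. 0) = 0"
    using K_add_right[of x "\<lambda>_ _. 0" "\<lambda>_ _. 0"] by simp
  moreover have "opOm N N h = (\<lambda>_ _. 0)"
    by (simp add: opOm_def fun_eq_iff)
  ultimately show ?case by (simp add: K_0)
next
  case (step k)
  have "opOm N k h = (\<lambda>n d. opS q N k (opZ q N k h) n d + opOm N (Suc k) h n d)"
    using step q_nonzero by (simp add: opS_opZ fun_eq_iff)
  then show ?case
    using step by (simp add: Om_rec distrib_right mult.assoc K_add K_Z K_S K_add_right)
qed

text \<open>Induction on the total degree. Removing one z_j or w_j at place j costs a power of q,
  and the operator produces the same power: for n = 0 the exponent \<nu> vanishes and only \<delta>
  remains.\<close>

lemma K_GP: "(\<forall>i\<ge>N. d i = 0) \<Longrightarrow> K (GP d) h = h (\<lambda>_. 0) d"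
proof (induction "\<Sum>i<N. nat \<bar>d i\<bar>" arbitrary: d h rule: less_induct)
  case less
  have GP_E: "GP d' = E (\<lambda>_. 0) d'" for d'
  proof -
    have "oprod (\<lambda>_. 1) k = 1" for k by (induction k) auto
    then show ?thesis by (simp add: E_def OmP_def)
  qed
  consider "\<forall>i<N. d i = 0" | j where "j < N" "d j > 0" | j where "j < N" "d j < 0"
    by (meson linorder_cases)
  then show ?case
  proof cases
    case 1
    then have "d = (\<lambda>_. 0)" using less.prems by (auto simp: fun_eq_iff not_less[symmetric])
    then show ?thesis by (simp add: GP_E E_0 K_1)
  next
    case (2 j)
    define d' where "d' = add_at j (-1) d"
    have *: "d' j \<ge> 0" "add_at j 1 d' = d"
      using 2 by (auto simp: d'_def add_at_eq add_at_same)
    have "(\<Sum>i<N. nat \<bar>d' i\<bar>) < (\<Sum>i<N. nat \<bar>d i\<bar>)"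
      using 2 by (intro sum_strict_mono_ex1) (auto simp: d'_def add_at_def)
    moreover have "\<forall>i\<ge>N. d' i = 0"
      using 2 less.prems by (auto simp: d'_def add_at_def)
    ultimately have "K (GP d') (opZ q N j h) = opZ q N j h (\<lambda>_. 0) d'"
      using less.hyps by blast
    moreover have "K (Z j * GP d') h = q powi \<delta> j d' * K (GP d) h"
      using 2 * Z_mult_GP_nonneg[of j d'] by (simp add: K_scale add_at_def)
    moreover have "opZ q N j h (\<lambda>_. 0) d' = q powi \<delta> j d' * h (\<lambda>_. 0) d"
      using * by (simp add: opZ_def)
    ultimately show ?thesis
      using 2 q_nonzero by (simp add: K_Z)
  next
    case (3 j)
    define d' where "d' = add_at j 1 d"
    have *: "d' j \<le> 0" "add_at j (-1) d' = d"
      using 3 by (auto simp: d'_def add_at_eq add_at_same)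
    have "(\<Sum>i<N. nat \<bar>d' i\<bar>) < (\<Sum>i<N. nat \<bar>d i\<bar>)"
      using 3 by (intro sum_strict_mono_ex1) (auto simp: d'_def add_at_def)
    moreover have "\<forall>i\<ge>N. d' i = 0"
      using 3 less.prems by (auto simp: d'_def add_at_def)
    ultimately have "K (GP d') (opS q N j h) = opS q N j h (\<lambda>_. 0) d'"
      using less.hyps by blast
    moreover have "K (S j * GP d') h = q powi \<delta> j d' * K (GP d) h"
      using 3 * S_mult_GP_nonpos[of j d'] by (simp add: K_scale add_at_def)
    moreover have "opS q N j h (\<lambda>_. 0) d' = q powi \<delta> j d' * h (\<lambda>_. 0) d"
      using * by (simp add: opS_def)
    ultimately show ?thesis
      using 3 q_nonzero by (simp add: K_S)
  qed
qed

text \<open>This is linear independence: the delta function at (n, d) pairs to 1 with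
  \<open>E n d\<close> and to 0 with every other monomial of supported index.\<close>

lemma K_E: "(n, d) \<in> supported \<Longrightarrow> K (E n d) h = h n d"
proof (induction "\<Sum>i<N. n i" arbitrary: n h rule: less_induct)
  case less
  show ?case
  proof (cases "\<forall>i<N. n i = 0")
    case True
    then have "n = (\<lambda>_. 0)"
      using less.prems by (auto simp: fun_eq_iff supported_def not_less[symmetric])
    moreover have "oprod (\<lambda>_. 1) k = 1" for k by (induction k) auto
    ultimately have "E n d = GP d" by (simp add: E_def OmP_def)
    then show ?thesis
      using less.prems \<open>n = (\<lambda>_. 0)\<close> by (simp add: K_GP supported_def)
  next
    case False
    then obtain k where k: "k < N" "n k > 0" by auto
    define n' where "n' = n(k := n k - 1)"
    have n: "n = add_at k 1 n'"
      using k by (auto simp: n'_def add_at_def)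
    have "(\<Sum>i<N. n' i) < (\<Sum>i<N. n i)"
      using k by (intro sum_strict_mono_ex1) (auto simp: n'_def)
    moreover have "(n', d) \<in> supported"
      using less.prems by (auto simp: supported_def n'_def)
    ultimately have "K (E n' d) (opOm N k h) = opOm N k h n' d"
      using less.hyps by blast
    then show ?thesis
      using k(1) K_Om[of k "E n' d" h] Om_mult_E[of k n' d] by (simp add: n opOm_def)
  qed
qed

text \<open>Only the basis vector of index \<open>s\<^sub>0\<close> contributes to the test function \<open>h\<close>, so a vector
  commuting with \<open>u\<close> can involve that basis vector only if the latter commutes with \<open>u\<close>.\<close>

lemma weight_trivial:
  assumes "finite T" and c: "\<And>s. s \<in> T \<Longrightarrow> c s \<noteq> 0"
    and comm: "u * (\<Sum>s\<in>T. c s \<cdot> case_prod E s) = (\<Sum>s\<in>T. c s \<cdot> case_prod E s) * u"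
    and weight: "\<And>s. s \<in> T \<Longrightarrow> qc (w s) u (case_prod E s)"
    and "s\<^sub>0 \<in> T" "K (u * case_prod E s\<^sub>0) h \<noteq> 0"
    and "\<And>s. s \<in> T \<Longrightarrow> s \<noteq> s\<^sub>0 \<Longrightarrow> K (u * case_prod E s) h = 0"
  shows "q powi w s\<^sub>0 = 1"
proof -
  let ?u = "\<lambda>s. u * case_prod E s"
  have "(\<Sum>s\<in>T. c s \<cdot> ?u s) = (\<Sum>s\<in>T. c s \<cdot> (case_prod E s * u))"
    using comm by (simp add: sum_distrib_left sum_distrib_right sm_mult_left sm_mult_right)
  also have "\<dots> = (\<Sum>s\<in>T. (c s * q powi (- w s)) \<cdot> ?u s)"
    using weight[THEN qc_sym] by (intro sum.cong) (auto simp: qc_def)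
  finally have "K (\<Sum>s\<in>T. c s \<cdot> ?u s) h = K (\<Sum>s\<in>T. (c s * q powi (- w s)) \<cdot> ?u s) h"
    by simp
  then have "(\<Sum>s\<in>T. c s * K (?u s) h) = (\<Sum>s\<in>T. (c s * q powi (- w s)) * K (?u s) h)"
    by (simp only: K_sum K_scale)
  moreover have "(\<Sum>s\<in>T. a s * K (?u s) h) = a s\<^sub>0 * K (?u s\<^sub>0) h" for a
  proof -
    have "(\<Sum>s\<in>T - {s\<^sub>0}. a s * K (?u s) h) = 0"
      using assms(7) by (intro sum.neutral) auto
    then show ?thesis
      using \<open>finite T\<close> \<open>s\<^sub>0 \<in> T\<close> by (simp add: sum.remove[of T s\<^sub>0])
  qed
  ultimately show ?thesis
    using assms(5,6) c by (simp add: power_int_minus)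
qed

end

section \<open>Central elements at a root of unity\<close>

locale q_sphere_root = q_sphere sm q N Z S
  for sm :: "complex \<Rightarrow> 'a::{ring,monoid_mult} \<Rightarrow> 'a" (infixr "\<cdot>" 75) and q N Z S +
  fixes m :: nat
  assumes N_ge_2: "N \<ge> 2" and odd_m: "odd m" and prim: "primitive_root_of_unity m q"
begin

lemma q_powi_eq_1_iff: "q powi k = 1 \<longleftrightarrow> int m dvd k"
proof -
  have m: "m > 0" "q ^ m = 1" "\<And>k. 0 < k \<Longrightarrow> k < m \<Longrightarrow> q ^ k \<noteq> 1"
    using prim unfolding primitive_root_of_unity_def by blast+
  obtain r where r: "k mod int m = int r" "r < m"
    using m(1) by (metis nat_int of_nat_0_less_iff pos_mod_bound pos_mod_sign zero_le_imp_eq_int of_nat_less_iff)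
  have "q powi k = q powi (int m * (k div int m) + int r)"
    using r(1) by (metis mult_div_mod_eq)
  also have "\<dots> = q ^ r"
    unfolding q_powi_add power_int_mult power_int_of_nat m(2) by simp
  finally have "q powi k = 1 \<longleftrightarrow> r = 0"
    using m(3)[of r] r(2) by (cases "r = 0") auto
  then show ?thesis
    unfolding dvd_eq_mod_eq_0 r(1) by simp
qed

lemma dvd_double: "int m dvd 2 * k \<Longrightarrow> int m dvd k"
  using odd_m coprime_dvd_mult_right_iff[of "int m" 2 k] by simp

lemma qc_mod:
  assumes "qc k x y" "int m dvd k - l"
  shows "qc l x y"
proof -
  have "q powi k = q powi ((k - l) + l)"
    by simp
  also have "\<dots> = q powi l"
    unfolding q_powi_add using assms(2) q_powi_eq_1_iff by simp
  finally show ?thesis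
    using assms(1) by (simp add: qc_def)
qed

lemma qc_mod_0: "qc k x y \<Longrightarrow> int m dvd k \<Longrightarrow> qc 0 x y"
  using qc_mod[of k x y 0] by simp

lemma m_pos: "m > 0"
  using odd_m by (rule odd_pos)

text \<open>Write m = n + 1. In w_i z_i^m = (Om_i - q^2 Om_{i+1}) z_i^n, moving z_i^n to the front
  uses up exactly the q^2, because q^{-2n} = q^2. What remains is z_i^n (Om_i - Om_{i+1}) = z_i^n
  (z_i w_i).\<close>

lemma Z_power_S: "i < N \<Longrightarrow> qc 0 (S i) (Z i ^ m)"
proof -
  assume i: "i < N"
  obtain n where n: "m = Suc n" using m_pos gr0_conv_Suc by auto
  have c: "Z i ^ n * Om i = Om i * Z i ^ n"
    by (rule power_commuting_commutes) (use Z_Om_le i in simp)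
  have "qc (int n * - 2) (Z i ^ n) (Om (Suc i))"
    using qc_power_left[OF Z_Om_gt[of i "Suc i"]] i by simp
  then have "qc 2 (Z i ^ n) (Om (Suc i))"
    by (rule qc_mod, intro dvdI[of _ _ "-2"]) (simp add: n algebra_simps)
  then have c': "Z i ^ n * Om (Suc i) = q\<^sup>2 \<cdot> (Om (Suc i) * Z i ^ n)"
    by (simp add: qc_def)
  have "S i * Z i ^ m = S i * Z i * Z i ^ n"
    by (simp add: n mult.assoc)
  also have "\<dots> = Z i ^ n * (Z i * S i)"
    unfolding S_mult_Z[OF i] Z_mult_S[OF i]
    by (simp add: left_diff_distrib right_diff_distrib c c' sm_mult_left)
  also have "\<dots> = Z i ^ m * S i"
    by (simp add: n power_commutes mult.assoc flip: power_Suc2)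
      (simp add: power_commutes flip: mult.assoc)
  finally show ?thesis by (simp add: qc_0_iff)
qed

lemma S_power_Z: "i < N \<Longrightarrow> qc 0 (Z i) (S i ^ m)"
proof -
  assume i: "i < N"
  obtain n where n: "m = Suc n" using m_pos gr0_conv_Suc by auto
  have c: "S i ^ n * Om i = Om i * S i ^ n"
    by (rule power_commuting_commutes) (use S_Om_le i in simp)
  have "qc (int n * 2) (S i ^ n) (Om (Suc i))"
    using qc_power_left[OF S_Om_gt[of i "Suc i"]] i by simp
  then have "qc (-2) (S i ^ n) (Om (Suc i))"
    by (rule qc_mod, intro dvdI[of _ _ 2]) (simp add: n algebra_simps)
  then have c': "q\<^sup>2 \<cdot> (S i ^ n * Om (Suc i)) = Om (Suc i) * S i ^ n"
    by (simp add: qc_def power_int_minus q_nonzero)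
  have "Z i * S i ^ m = Z i * S i * S i ^ n"
    by (simp add: n mult.assoc)
  also have "\<dots> = S i ^ n * (S i * Z i)"
    unfolding S_mult_Z[OF i] Z_mult_S[OF i]
    by (simp add: left_diff_distrib right_diff_distrib c c' sm_mult_right)
  also have "\<dots> = S i ^ m * Z i"
    by (simp add: n power_commutes mult.assoc flip: power_Suc2)
      (simp add: power_commutes flip: mult.assoc)
  finally show ?thesis by (simp add: qc_0_iff)
qed

lemma central_Z_power: "i < N \<Longrightarrow> central (Z i ^ m)"
  unfolding central_def
proof (intro allI impI conjI)
  fix j assume ij: "i < N" "j < N"
  show "qc 0 (Z j) (Z i ^ m)"
    using qc_mod_0[OF qc_power_right[OF Z_Z[of j i], of m]] qc_mod_0[OF qc_power_right[OF Z_Z'[of i j], of m]] ij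
    by (cases i j rule: linorder_cases) (auto simp: qc_0_iff power_commutes)
  show "qc 0 (S j) (Z i ^ m)"
    using qc_power_right[OF S_Z, of j i m] ij Z_power_S
    by (cases "i = j") (auto elim: qc_mod_0)
qed

lemma central_S_power: "i < N \<Longrightarrow> central (S i ^ m)"
  unfolding central_def
proof (intro allI impI conjI)
  fix j assume ij: "i < N" "j < N"
  show "qc 0 (S j) (S i ^ m)"
    using qc_mod_0[OF qc_power_right[OF S_S[of j i], of m]] qc_mod_0[OF qc_power_right[OF S_S'[of i j], of m]] ij
    by (cases i j rule: linorder_cases) (auto simp: qc_0_iff power_commutes)
  show "qc 0 (Z j) (S i ^ m)"
    using qc_power_right[OF Z_S, of j i m] ij S_power_Z
    by (cases "i = j") (auto elim: qc_mod_0)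
qed

lemma G_eq_power:
  assumes "int m dvd d"
  shows "\<exists>k. G i d = (Z i ^ m) ^ k \<or> G i d = (S i ^ m) ^ k"
proof -
  obtain l where l: "d = int m * l" using assms by auto
  have "nat (int m * l) = m * nat l" "nat (- (int m * l)) = m * nat (- l)"
    using nat_mult_distrib[of "int m" l] nat_mult_distrib[of "int m" "- l"] by simp_all
  then show ?thesis
    by (auto simp: G_def l power_mult)
qed

lemma central_G: "i < N \<Longrightarrow> int m dvd d \<Longrightarrow> central (G i d)"
  using G_eq_power[of d i] by (auto simp: central_power central_Z_power central_S_power)

text \<open>Both products equal \<open>Om (N - 1)\<close>, because \<open>Om N = 0\<close>.\<close>

lemma Z_S_last: "Z (N - 1) * S (N - 1) = S (N - 1) * Z (N - 1)"
  using N_ge_2 by (simp add: Z_mult_S S_mult_Z)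

lemma central_Z_S_last:
  assumes "a + b = m"
  shows "central (Z (N - 1) ^ a * S (N - 1) ^ b)"
  unfolding central_def
proof (intro allI impI conjI)
  fix j assume j: "j < N"
  have ab: "int a + int b = int m" using assms by simp
  show "qc 0 (Z j) (Z (N - 1) ^ a * S (N - 1) ^ b)"
  proof (cases "j = N - 1")
    case True
    then show ?thesis
      using qc_mult_right[of 0 "Z j" "Z j ^ a" 0 "S j ^ b"] qc_power_right[of 0 "Z j" _ b] Z_S_last
        qc_power_right[of 0 "Z j" _ a]
      by (auto simp: qc_0_iff)
  next
    case False
    then have "qc (int a * - 1 + int b * - 1) (Z j) (Z (N - 1) ^ a * S (N - 1) ^ b)"
      using j by (intro qc_mult_right qc_power_right Z_Z Z_S) auto
    then show ?thesis
      by (rule qc_mod_0, intro dvdI[of _ _ "-1"]) (use ab in simp)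
  qed
  show "qc 0 (S j) (Z (N - 1) ^ a * S (N - 1) ^ b)"
  proof (cases "j = N - 1")
    case True
    then show ?thesis
      using qc_mult_right[of 0 "S j" "Z j ^ a" 0 "S j ^ b"] qc_power_right[of 0 "S j" _ b] Z_S_last
        qc_power_right[of 0 "S j" _ a]
      by (auto simp: qc_0_iff)
  next
    case False
    then have "qc (int a * 1 + int b * 1) (S j) (Z (N - 1) ^ a * S (N - 1) ^ b)"
      using j by (intro qc_mult_right qc_power_right S_S S_Z) auto
    then show ?thesis
      by (rule qc_mod_0) (use ab in simp)
  qed
qed

text \<open>The first condition comes from the Om_k, the second from z_j or w_j. The exponent
  \<open>n 0\<close> occurs in no \<open>\<nu> j n\<close> and stays free, in accordance with the
  centrality of \<open>Om 0\<close>; the last exponent of d is tied only to n.\<close>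

definition central_index :: "(nat \<Rightarrow> nat) \<Rightarrow> (nat \<Rightarrow> int) \<Rightarrow> bool" where
  "central_index n d \<longleftrightarrow> (\<forall>k<N - 1. int m dvd d k) \<and> (\<forall>j<N - 1. int m dvd 2 * \<nu> j n + \<bar>d (N - 1)\<bar>)"

text \<open>All factors of \<open>GP d\<close> except the last are central, so only the last one
  contributes to the weight.\<close>

lemma qc_GP_central_index:
  assumes "\<And>k. k < N - 1 \<Longrightarrow> int m dvd d k" "j < N - 1"
  shows "qc (- \<bar>d (N - 1)\<bar>) (Z j) (GP d)" "qc \<bar>d (N - 1)\<bar> (S j) (GP d)"
proof -
  obtain M where M: "N = Suc M" using N_ge_2 by (cases N) auto
  have "central (oprod (\<lambda>i. G i (d i)) M)"
    by (rule central_oprod, rule central_G) (use assms M in auto)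
  then have "qc 0 (Z j) (oprod (\<lambda>i. G i (d i)) M)" "qc 0 (S j) (oprod (\<lambda>i. G i (d i)) M)"
    using assms(2) by (auto simp: central_def)
  then have "qc (0 + - \<bar>d M\<bar>) (Z j) (oprod (\<lambda>i. G i (d i)) M * G M (d M))"
    "qc (0 + \<bar>d M\<bar>) (S j) (oprod (\<lambda>i. G i (d i)) M * G M (d M))"
    using assms(2) M by (intro qc_mult_right qc_Z_G_gt qc_S_G_gt; simp)+
  moreover have "GP d = oprod (\<lambda>i. G i (d i)) M * G M (d M)"
    unfolding GP_def by (subst M) simp
  ultimately show "qc (- \<bar>d (N - 1)\<bar>) (Z j) (GP d)" "qc \<bar>d (N - 1)\<bar> (S j) (GP d)"
    using M by simp_all
qed

end

locale q_sphere_center = q_sphere_root sm q N Z S m + q_sphere_functional sm q N Z S K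
  for sm :: "complex \<Rightarrow> 'a::{ring,monoid_mult} \<Rightarrow> 'a" (infixr "\<cdot>" 75) and q N Z S m K
begin

lemma central_imp_central_index:
  assumes Y: "central (\<Sum>s\<in>T. c s \<cdot> case_prod E s)" and T: "finite T" "T \<subseteq> supported"
    and c: "\<And>s. s \<in> T \<Longrightarrow> c s \<noteq> 0" and s0: "(n\<^sub>0, d\<^sub>0) \<in> T"
  shows "central_index n\<^sub>0 d\<^sub>0"
proof -
  let ?Y = "\<Sum>s\<in>T. c s \<cdot> case_prod E s"
  have YZ: "Z j * ?Y = ?Y * Z j" and YS: "S j * ?Y = ?Y * S j" if "j < N" for j
    using Y that by (auto simp: central_def qc_0_iff)
  have YOm: "Om k * ?Y = ?Y * Om k" for k
  proof -
    have "qc (0 + 0) ?Y (Z i * S i)" if "i < N" for i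
      using YZ[OF that] YS[OF that] by (intro qc_mult_right) (auto simp: qc_0_iff)
    then have "qc 0 ?Y (Om k)"
      unfolding Om_def by (intro qc_sum_right) auto
    then show ?thesis by (simp add: qc_0_iff)
  qed
  have d_dvd: "int m dvd d k" if s: "(n, d) \<in> T" "k < N - 1" for n d k
  proof -
    have \<delta>: "int m dvd \<delta> k d" if k: "k < N" for k
    proof -
      \<comment> \<open>The delta function at the index to which \<open>Om k\<close> moves (n, d).
        The move is injective, so no other index in T is detected.\<close>
      define h where "h = (\<lambda>n' d'. if n' = add_at k 1 n \<and> d' = d then 1 else 0 :: complex)"
      have K: "K (Om k * case_prod E s') h \<noteq> 0 \<longleftrightarrow> s' = (n, d)" if "s' \<in> T" for s'
        using that T k by (cases s') (auto simp: K_Om K_E subset_iff opOm_def h_def add_at_inject)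
      have "q powi (2 * \<delta> k (snd (n, d))) = 1"
        by (rule weight_trivial[OF T(1) c YOm[of k] _ s(1), where w = "\<lambda>s. 2 * \<delta> k (snd s)" and h = h])
          (use K s(1) qc_Om_E k in \<open>auto split: prod.splits\<close>)
      then show ?thesis
        using q_powi_eq_1_iff[of "2 * \<delta> k d"] dvd_double[of "\<delta> k d"] by simp
    qed
    \<comment> \<open>The exponent \<open>d k\<close> is recovered as a difference of partial sums;
      \<open>\<delta> (Suc k) d\<close> is available only for \<open>Suc k < N\<close>, so the last
      exponent escapes.\<close>
    have "int m dvd \<delta> (Suc k) d - \<delta> k d"
      by (intro dvd_diff \<delta>) (use s in auto)
    then show ?thesis by simp
  qed
  have "int m dvd 2 * \<nu> j n\<^sub>0 + \<bar>d\<^sub>0 (N - 1)\<bar>" if j: "j < N - 1" for j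
  proof (cases "d\<^sub>0 j \<ge> 0")
    case True
    have jN: "j < N" using j by simp
    \<comment> \<open>Indices with \<open>d j < 0\<close>, for which z_j yields two terms, are sent
      to exponents at most 0 at j, whereas h sits at a positive one. So they are not detected, and
      z_j acts as an injective shift on the rest.\<close>
    define h where "h = (\<lambda>n d. if n = n\<^sub>0 \<and> d = add_at j 1 d\<^sub>0 then 1 else 0 :: complex)"
    \<comment> \<open>Divisibility of the exponents is used here for every index in T, since all
      terms of the sum must be weight vectors for z_j.\<close>
    have w: "qc (- 2 * \<nu> j n + - \<bar>d (N - 1)\<bar>) (Z j) (E n d)" if "(n, d) \<in> T" for n d
      unfolding E_def by (intro qc_mult_right qc_Z_OmP qc_GP_central_index) (use d_dvd that j jN in auto)
    have K: "K (Z j * case_prod E s') h \<noteq> 0 \<longleftrightarrow> s' = (n\<^sub>0, d\<^sub>0)" if "s' \<in> T" for s'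
      using that T jN True q_nonzero by (cases s') (auto simp: K_Z K_E subset_iff opZ_def Let_def opOm_def h_def add_at_inject)
    have "q powi (case (n\<^sub>0, d\<^sub>0) of (n, d) \<Rightarrow> - 2 * \<nu> j n + - \<bar>d (N - 1)\<bar>) = 1"
      by (rule weight_trivial[OF T(1) c YZ[OF jN] _ s0, where h = h])
        (use K s0 w in \<open>auto split: prod.splits\<close>)
    then have "int m dvd - (2 * \<nu> j n\<^sub>0 + \<bar>d\<^sub>0 (N - 1)\<bar>)"
      by (simp add: q_powi_eq_1_iff algebra_simps)
    then show ?thesis
      by (simp only: dvd_minus_iff)
  next
    case False
    have jN: "j < N" using j by simp
    define h where "h = (\<lambda>n d. if n = n\<^sub>0 \<and> d = add_at j (-1) d\<^sub>0 then 1 else 0 :: complex)"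
    have w: "qc (2 * \<nu> j n + \<bar>d (N - 1)\<bar>) (S j) (E n d)" if "(n, d) \<in> T" for n d
      unfolding E_def by (intro qc_mult_right qc_S_OmP qc_GP_central_index) (use d_dvd that j jN in auto)
    have K: "K (S j * case_prod E s') h \<noteq> 0 \<longleftrightarrow> s' = (n\<^sub>0, d\<^sub>0)" if "s' \<in> T" for s'
      using that T jN False q_nonzero by (cases s') (auto simp: K_S K_E subset_iff opS_def Let_def opOm_def h_def add_at_inject)
    have "q powi (case (n\<^sub>0, d\<^sub>0) of (n, d) \<Rightarrow> 2 * \<nu> j n + \<bar>d (N - 1)\<bar>) = 1"
      by (rule weight_trivial[OF T(1) c YS[OF jN] _ s0, where h = h])
        (use K s0 w in \<open>auto split: prod.splits\<close>)
    then show ?thesis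
      by (simp add: q_powi_eq_1_iff algebra_simps)
  qed
  then show ?thesis
    using d_dvd s0 by (auto simp: central_index_def)
qed

end

section \<open>Homogenized polynomials and the products z_i^k w_i^k\<close>

context q_algebra
begin

text \<open>The homogenization y^k p(x/y) of p in degree k, at commuting x and y; k is a separate
  argument that is meant to be at least the degree of p.\<close>

definition homog_eval :: "complex poly \<Rightarrow> nat \<Rightarrow> 'a \<Rightarrow> 'a \<Rightarrow> 'a" where
  "homog_eval p k x y = (\<Sum>i\<le>k. coeff p i \<cdot> (x ^ i * y ^ (k - i)))"

lemma homog_eval_mult_linear:
  assumes "degree p \<le> k" and xy: "x * y = y * x"
  shows "homog_eval (p * [:- r, 1:]) (Suc k) x y = (x - r \<cdot> y) * homog_eval p k x y"
proof -
  have "homog_eval (p * [:- r, 1:]) (Suc k) x y =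
      homog_eval (pCons 0 p) (Suc k) x y - r \<cdot> homog_eval p (Suc k) x y"
    unfolding homog_eval_def scale_sum_right sum_subtractf[symmetric]
    by (intro sum.cong) (simp_all add: scale_left_diff_distrib)
  also have "homog_eval (pCons 0 p) (Suc k) x y = x * homog_eval p k x y"
    unfolding homog_eval_def
    by (subst sum.atMost_Suc_shift) (simp add: sum_distrib_left sm_mult_right mult.assoc)
  also have "homog_eval p (Suc k) x y = y * homog_eval p k x y"
  proof -
    have "y * x ^ i = x ^ i * y" for i
      using power_commuting_commutes[OF xy] by simp
    then have "y * (x ^ i * y ^ (k - i)) = x ^ i * y ^ (Suc k - i)" if "i \<le> k" for i
      using that by (simp add: Suc_diff_le flip: mult.assoc)
    moreover have "coeff p (Suc k) = 0"
      using assms(1) by (simp add: coeff_eq_0)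
    ultimately show ?thesis
      by (simp add: homog_eval_def sum_distrib_left sm_mult_right)
  qed
  finally show ?thesis
    by (simp add: left_diff_distrib sm_mult_left)
qed

end

context q_sphere
begin

text \<open>In z_i^k (z_i w_i) w_i^k the inner product is Om_i - Om_{i+1}. Pulling it out to the
  left through z_i^k multiplies Om_{i+1} by q^{-2k}, which gives the next linear factor.\<close>

lemma Z_power_mult_S_power:
  assumes "i < N"
  shows "Z i ^ k * S i ^ k = homog_eval (\<Prod>l<k. [:- (q powi (- 2 * int l)), 1:]) k (Om i) (Om (Suc i))"
proof (induction k)
  case 0
  then show ?case by (simp add: homog_eval_def)
next
  case (Suc k)
  have comm: "Om i * Om (Suc i) = Om (Suc i) * Om i"
    using Om_commute[of i "Suc i"] assms by (cases "Suc i = N") auto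
  have c: "Z i ^ k * Om i = Om i * Z i ^ k"
    by (rule power_commuting_commutes) (use Z_Om_le assms in simp)
  have "qc (int k * - 2) (Z i ^ k) (Om (Suc i))"
    using qc_power_left[OF Z_Om_gt[of i "Suc i"]] assms by simp
  then have c': "Z i ^ k * Om (Suc i) = q powi (- 2 * int k) \<cdot> (Om (Suc i) * Z i ^ k)"
    by (simp add: qc_def mult.commute)
  have "Z i ^ Suc k * S i ^ Suc k = Z i ^ k * (Z i * S i) * S i ^ k"
    by (simp add: power_commutes mult.assoc) (simp add: power_commutes flip: mult.assoc)
  also have "\<dots> = (Om i - q powi (- 2 * int k) \<cdot> Om (Suc i)) * (Z i ^ k * S i ^ k)"
    unfolding Z_mult_S[OF assms]
    by (simp only: right_diff_distrib left_diff_distrib c c' sm_mult_left mult.assoc)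
  also have "degree (\<Prod>l<k. [:- (q powi (- 2 * int l)), 1:]) = k"
    by (subst degree_prod_eq_sum_degree) auto
  then have "(Om i - q powi (- 2 * int k) \<cdot> Om (Suc i)) * (Z i ^ k * S i ^ k) =
      homog_eval (\<Prod>l<Suc k. [:- (q powi (- 2 * int l)), 1:]) (Suc k) (Om i) (Om (Suc i))"
    unfolding Suc.IH prod.lessThan_Suc by (intro homog_eval_mult_linear[symmetric] comm) simp
  finally show ?case .
qed

end

context q_sphere_root
begin

lemma Om_power_m:
  assumes "i < N"
  shows "Om i ^ m = Z i ^ m * S i ^ m + Om (Suc i) ^ m"
proof -
  let ?w = "q powi (-2)"
  have eq: "?w ^ k = q powi (- 2 * int k)" for k
    by (simp flip: power_int_mult power_int_of_nat)
  \<comment> \<open>Since m is odd, the factor 2 in the exponent can be cancelled modulo m, so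
    q^{-2} again has order m.\<close>
  have w1: "?w ^ k = 1 \<longleftrightarrow> int m dvd int k" for k
    unfolding eq q_powi_eq_1_iff using dvd_double[of "int k"] by auto
  have "(\<Prod>l<m. [:- (?w ^ l), 1:]) = monom 1 m - 1"
  proof (rule prod_linear_roots_of_unity)
    show "?w ^ m = 1" unfolding w1 by simp
    show "?w ^ k \<noteq> 1" if "0 < k" "k < m" for k
      unfolding w1 using that zdvd_not_zless[of "int k" "int m"] by simp
  qed (rule m_pos)
  then have "Z i ^ m * S i ^ m = homog_eval (monom 1 m - 1) m (Om i) (Om (Suc i))"
    unfolding Z_power_mult_S_power[OF assms] eq by simp
  also have "\<dots> = (\<Sum>j\<le>m. if j = m then Om i ^ m else if j = 0 then - (Om (Suc i) ^ m) else 0)"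
    unfolding homog_eval_def using m_pos by (intro sum.cong) (auto simp: coeff_1)
  also have "\<dots> = (\<Sum>j\<in>{0, m}. if j = m then Om i ^ m else if j = 0 then - (Om (Suc i) ^ m) else 0)"
    by (rule sum.mono_neutral_right) auto
  also have "\<dots> = Om i ^ m - Om (Suc i) ^ m"
    using m_pos by simp
  finally show ?thesis by simp
qed

lemma central_commutes_Om: "central x \<Longrightarrow> i \<le> N \<Longrightarrow> x * Om i = Om i * x"
proof -
  assume x: "central x"
  have "qc (0 + 0) x (Z k * S k)" if "k < N" for k
    using x that by (intro qc_mult_right) (auto simp: central_def qc_0_iff)
  then have "qc 0 x (Om i)"
    unfolding Om_def by (intro qc_sum_right) auto
  then show ?thesis by (simp add: qc_0_iff)
qed

lemma Om_last_power: "Om (N - 1) ^ k = Z (N - 1) ^ k * S (N - 1) ^ k"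
  using N_ge_2 Z_mult_S[of "N - 1"] power_mult_commuting[OF Z_S_last] by simp

text \<open>B is an abstract set with closure properties, so that it can later be the preimage of
  the generated subring of one component.\<close>

lemma central_index_in_subalgebra:
  assumes one: "1 \<in> B" and mult: "\<And>x y. x \<in> B \<Longrightarrow> y \<in> B \<Longrightarrow> x * y \<in> B"
    and add: "\<And>x y. x \<in> B \<Longrightarrow> y \<in> B \<Longrightarrow> x + y \<in> B" and scale: "\<And>c x. x \<in> B \<Longrightarrow> c \<cdot> x \<in> B"
    and Om0: "Om 0 \<in> B" and Zm: "\<And>i. i < N \<Longrightarrow> Z i ^ m \<in> B" and Sm: "\<And>i. i < N \<Longrightarrow> S i ^ m \<in> B"
    and ZS: "\<And>a b. a \<in> {1..m - 1} \<Longrightarrow> b \<in> {1..m - 1} \<Longrightarrow> a + b = m \<Longrightarrow>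
      Z (N - 1) ^ a * S (N - 1) ^ b \<in> B"
    and central_index: "central_index n d"
  shows "E n d \<in> B"
proof -
  obtain M where M: "N = Suc M" "M > 0" using N_ge_2 by (cases N) auto
  have power: "x ^ k \<in> B" if "x \<in> B" for x k
    using that by (induction k) (auto intro: one mult)
  have oprod: "oprod f k \<in> B" if "\<And>i. i < k \<Longrightarrow> f i \<in> B" for f k
    using that by (induction k) (auto intro: one mult)
  \<comment> \<open>Central m-th powers are split off until both exponents are below m. Then a + b <
    2m forces a + b = 0 or a + b = m, and in the latter case both exponents are at least 1, as the
    given generators require.\<close>
  have ZS_dvd: "Z M ^ a * S M ^ b \<in> B" if "m dvd a + b" for a b
    using that
  proof (induction "a + b" arbitrary: a b rule: less_induct)
    case less
    consider "a \<ge> m" | "b \<ge> m" | "a < m" "b < m" by linarith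
    then show ?case
    proof cases
      case 1
      have "m dvd (a - m) + b"
        using less.prems 1 by (metis Nat.add_diff_assoc2 dvd_diff_nat dvd_refl)
      then have "Z M ^ m * (Z M ^ (a - m) * S M ^ b) \<in> B"
        using 1 m_pos M by (intro mult Zm less.hyps) auto
      then show ?thesis
        using 1 by (simp flip: mult.assoc power_add)
    next
      case 2
      have "m dvd a + (b - m)"
        using less.prems 2 by (metis Nat.add_diff_assoc dvd_diff_nat dvd_refl)
      then have "(Z M ^ a * S M ^ (b - m)) * S M ^ m \<in> B"
        using 2 m_pos M by (intro mult Sm less.hyps) auto
      then show ?thesis
        using 2 by (simp add: mult.assoc flip: power_add)
    next
      case 3
      then have "a + b = 0 \<or> a + b = m"
        using nat_dvd_not_less[of "a + b - m" m] dvd_diff_nat[OF less.prems dvd_refl]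
          nat_dvd_not_less[of "a + b" m] less.prems by linarith
      then show ?thesis
        using ZS[of a b] 3 M one by auto
    qed
  qed
  \<comment> \<open>Downward induction by \<open>Om_power_m\<close>, starting from
    \<open>Om N ^ m = 0\<close>, where m > 0 matters.\<close>
  have Om_m: "Om i ^ m \<in> B" if "i \<le> N" for i
    using that
  proof (induction i rule: inc_induct)
    case base
    then show ?case using scale[OF one, of 0] m_pos by (cases m) auto
  next
    case (step i)
    then show ?case by (simp add: Om_power_m add mult Zm Sm)
  qed
  \<comment> \<open>The conditions at i - 1 and i differ by \<open>2 * n i\<close>; both are
    available only for 0 < i < M.\<close>
  have n_dvd: "m dvd n i" if i: "0 < i" "i < M" for i
  proof -
    have "int m dvd (2 * \<nu> (i - 1) n + \<bar>d (N - 1)\<bar>) - (2 * \<nu> i n + \<bar>d (N - 1)\<bar>)"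
      by (intro dvd_diff) (use central_index i M(1) in \<open>unfold central_index_def, auto\<close>)
    moreover have "{i - 1<..<N} = insert i {i<..<N}"
      using i M by auto
    ultimately have "int m dvd 2 * int (n i)"
      by simp
    then show ?thesis
      using dvd_double[of "int (n i)"] by simp
  qed
  have OmP: "oprod (\<lambda>i. Om i ^ n i) M \<in> B"
  proof (rule oprod)
    fix i assume i: "i < M"
    show "Om i ^ n i \<in> B"
    proof (cases "i = 0")
      case True
      then show ?thesis using Om0 power by simp
    next
      case False
      then obtain k where "n i = m * k"
        using n_dvd[of i] i by auto
      then show ?thesis
        using Om_m[of i] i M power by (simp add: power_mult)
    qed
  qed
  have GP: "oprod (\<lambda>i. G i (d i)) M \<in> B"
  proof (rule oprod)
    fix i assume i: "i < M"
    then have "int m dvd d i" using central_index M(1) unfolding central_index_def by simp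
    from G_eq_power[OF this, of i] show "G i (d i) \<in> B"
      using Zm[of i] Sm[of i] i M power by auto
  qed
  have last: "Om M ^ n M * G M (d M) \<in> B"
  proof -
    \<comment> \<open>The condition at j = M - 1 involves \<open>n M\<close> alone. It equals the
      total exponent of z_M and w_M below, which are n + d and n for d \<ge> 0, and n and n - d for
      d < 0.\<close>
    have "{M - 1<..<N} = {M}" using M by auto
    then have *: "int m dvd 2 * int (n M) + \<bar>d M\<bar>"
      using central_index M unfolding central_index_def by (auto dest!: spec[of _ "M - 1"])
    have Om: "Om M ^ n M = Z M ^ n M * S M ^ n M"
      using Om_last_power M by simp
    have SZ: "S M ^ a * Z M ^ b = Z M ^ b * S M ^ a" for a b
      using power_commuting_commutes[OF power_commuting_commutes[OF Z_S_last, symmetric], symmetric] M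
      by simp
    show ?thesis
    proof (cases "d M \<ge> 0")
      case True
      then have "m dvd (n M + nat (d M)) + n M"
        using * by (simp flip: int_dvd_int_iff)
      then have "Z M ^ (n M + nat (d M)) * S M ^ n M \<in> B"
        by (rule ZS_dvd)
      moreover have "Om M ^ n M * G M (d M) = Z M ^ (n M + nat (d M)) * S M ^ n M"
        unfolding Om G_def power_add mult.assoc using True SZ by simp
      ultimately show ?thesis by simp
    next
      case False
      then have "m dvd n M + (n M + nat (- d M))"
        using * by (simp flip: int_dvd_int_iff)
      then have "Z M ^ n M * S M ^ (n M + nat (- d M)) \<in> B"
        by (rule ZS_dvd)
      moreover have "Om M ^ n M * G M (d M) = Z M ^ n M * S M ^ (n M + nat (- d M))"
        unfolding Om G_def power_add mult.assoc using False by simp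
      ultimately show ?thesis by simp
    qed
  qed
  have "central (oprod (\<lambda>i. G i (d i)) M)"
    by (rule central_oprod, rule central_G) (use central_index M in \<open>unfold central_index_def, auto\<close>)
  \<comment> \<open>In \<open>E n d\<close> the power of \<open>Om M\<close> stands before all
    G-factors; the central ones are crossed so that it meets \<open>G M (d M)\<close>.\<close>
  then have comm: "Om M ^ k * (oprod (\<lambda>i. G i (d i)) M * x) = oprod (\<lambda>i. G i (d i)) M * (Om M ^ k * x)" for k x
    unfolding mult.assoc[symmetric]
    using power_commuting_commutes[OF central_commutes_Om[symmetric]] M by simp
  have "E n d = (oprod (\<lambda>i. Om i ^ n i) M * Om M ^ n M) * (oprod (\<lambda>i. G i (d i)) M * G M (d M))"
    unfolding E_def OmP_def GP_def by (subst (1 2) M(1)) simp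
  also have "\<dots> = oprod (\<lambda>i. Om i ^ n i) M * oprod (\<lambda>i. G i (d i)) M * (Om M ^ n M * G M (d M))"
    by (simp add: mult.assoc comm)
  also have "\<dots> \<in> B"
    by (intro mult OmP GP last)
  finally show ?thesis .
qed

text \<open>Commuting with the generators passes to the Om_i, then to powers and ordered products,
  hence to every \<open>E n d\<close>.\<close>

lemma central_commutes_basis_span:
  assumes x: "central x" and "y \<in> basis_span"
  shows "x * y = y * x"
  using assms(2) unfolding basis_span_def
proof (induction rule: span_induct)
  case base
  show ?case
    by (auto simp: subspace_def distrib_left distrib_right sm_mult_left sm_mult_right)
next
  case (step y)
  then obtain n d where y: "y = E n d" by auto
  have "qc (k * 0) x (G i c)" if "i < N" for i c k
  proof -
    have "qc 0 x (Z i)" "qc 0 x (S i)"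
      using x that by (auto simp: central_def qc_0_iff)
    then show ?thesis using qc_G_right[of 0 x i 0 c] by (simp split: if_splits)
  qed
  then have "qc (\<Sum>i<N. 0) x (GP d)"
    unfolding GP_def by (intro qc_oprod) auto
  moreover have "qc 0 x (Om i ^ k)" if "i < N" for i k
    using qc_power_right[of 0 x "Om i" k] central_commutes_Om[OF x, of i] that
    by (simp add: qc_0_iff)
  then have "qc (\<Sum>i<N. 0) x (OmP n)"
    unfolding OmP_def by (intro qc_oprod) auto
  ultimately show ?case
    using qc_mult_right[of 0 x "OmP n" 0 "GP d"] by (simp add: y E_def qc_0_iff)
qed

end

section \<open>Transfer to \<open>F_q(N)\<close>\<close>

abbreviation FA :: "nat \<Rightarrow> (letter word \<Rightarrow>\<^sub>0 complex) ring" where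
  "FA N \<equiv> free_algebra (Fq_letters N)"

lemma free_algebra_simps:
  "x \<otimes>\<^bsub>free_algebra S\<^esub> y = x * y" "x \<oplus>\<^bsub>free_algebra S\<^esub> y = x + y"
  "\<one>\<^bsub>free_algebra S\<^esub> = 1" "\<zero>\<^bsub>free_algebra S\<^esub> = 0"
  by (simp_all add: free_algebra_def)

lemma free_algebra_add_closed:
  "p \<in> carrier (free_algebra S) \<Longrightarrow> r \<in> carrier (free_algebra S) \<Longrightarrow> p + r \<in> carrier (free_algebra S)"
  using ring.ring_simprules(1)[OF ring_free_algebra, of p S r] by (simp add: free_algebra_simps)

lemma free_algebra_a_inv:
  assumes "p \<in> carrier (free_algebra S)"
  shows "\<ominus>\<^bsub>free_algebra S\<^esub> p = - p"
proof -
  interpret ring "free_algebra S" by (rule ring_free_algebra)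
  have "- p \<in> carrier (free_algebra S)"
    using assms by (simp add: free_algebra_def)
  then show ?thesis
    using assms by (intro minus_equality) (simp_all add: free_algebra_simps)
qed

lemma free_algebra_a_minus:
  "r \<in> carrier (free_algebra S) \<Longrightarrow> p \<ominus>\<^bsub>free_algebra S\<^esub> r = p - r"
  by (simp add: a_minus_def free_algebra_a_inv free_algebra_simps)

section \<open>The quotient map from the free algebra\<close>

lemma Fq_class_hom: "Fq_class q N \<in> ring_hom (FA N) (Fq q N)"
  unfolding Fq_class_def Fq_def by (rule ideal.rcos_ring_hom[OF ideal_Fq_ideal])

lemma Fq_class_closed: "p \<in> carrier (FA N) \<Longrightarrow> Fq_class q N p \<in> carrier (Fq q N)"
  using ring_hom_closed[OF Fq_class_hom] .

lemma Fq_class_mult: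
  "p \<in> carrier (FA N) \<Longrightarrow> r \<in> carrier (FA N) \<Longrightarrow> Fq_class q N (p * r) = Fq_class q N p \<otimes>\<^bsub>Fq q N\<^esub> Fq_class q N r"
  using ring_hom_mult[OF Fq_class_hom] by (simp add: free_algebra_simps)

lemma Fq_class_add:
  "p \<in> carrier (FA N) \<Longrightarrow> r \<in> carrier (FA N) \<Longrightarrow> Fq_class q N (p + r) = Fq_class q N p \<oplus>\<^bsub>Fq q N\<^esub> Fq_class q N r"
  using ring_hom_add[OF Fq_class_hom] by (simp add: free_algebra_simps)

lemma Fq_class_one: "Fq_class q N 1 = \<one>\<^bsub>Fq q N\<^esub>"
  using ring_hom_one[OF Fq_class_hom] by (simp add: free_algebra_simps)

lemma Fq_class_zero: "Fq_class q N 0 = \<zero>\<^bsub>Fq q N\<^esub>"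
  using ring_hom_zero[OF Fq_class_hom ring_free_algebra ring_Fq] by (simp add: free_algebra_simps)

lemma Fq_class_eq_iff:
  "p \<in> carrier (FA N) \<Longrightarrow> r \<in> carrier (FA N) \<Longrightarrow> Fq_class q N p = Fq_class q N r \<longleftrightarrow> p - r \<in> Fq_ideal q N"
  using ring.quotient_eq_iff_same_a_r_cos[OF ring_free_algebra ideal_Fq_ideal, of p N r q]
  by (simp add: Fq_class_def free_algebra_a_minus)

lemma Fq_class_eqI:
  "p \<in> carrier (FA N) \<Longrightarrow> r \<in> carrier (FA N) \<Longrightarrow> p - r \<in> Fq_relators q N \<Longrightarrow> Fq_class q N p = Fq_class q N r"
  using ring.genideal_self[OF ring_free_algebra Fq_relators_in_carrier, of q N]
  by (auto simp: Fq_class_eq_iff Fq_ideal_def)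

lemma Fq_class_surj:
  assumes "x \<in> carrier (Fq q N)"
  obtains p where "p \<in> carrier (FA N)" "x = Fq_class q N p"
  using assms by (auto simp: Fq_def FactRing_def A_RCOSETS_def' Fq_class_def)

lemma scal_mult_commute: "scal c * p = p * scal c"
proof (induction p rule: poly_mapping_induct)
  case (single_add w c' p)
  then show ?case
    by (simp add: distrib_left distrib_right scal_def mult_single mult.commute)
qed simp

lemma scal_simps: "scal (a + b) = scal a + scal b" "scal (a * b) = scal a * scal b" "scal 1 = 1"
  by (simp_all add: scal_def single_add mult_single)

text \<open>
  The product of all the algebras \<open>F_q(N)\<close> is a type that does not depend on \<open>q\<close> and \<open>N\<close>,
  so it can be made an instance of the type classes of rings.
\<close>

typedef Fq_family = "{f. \<forall>q N. f q N \<in> carrier (Fq q N)}"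
  morphisms component Abs_Fq_family
  by (rule exI[of _ "\<lambda>q N. \<one>\<^bsub>Fq q N\<^esub>"]) (simp add: ring.ring_simprules[OF ring_Fq])

setup_lifting type_definition_Fq_family

instantiation Fq_family :: "{ring, monoid_mult}"
begin

lift_definition zero_Fq_family :: Fq_family is "\<lambda>q N. \<zero>\<^bsub>Fq q N\<^esub>"
  by (simp add: ring.ring_simprules[OF ring_Fq])

lift_definition one_Fq_family :: Fq_family is "\<lambda>q N. \<one>\<^bsub>Fq q N\<^esub>"
  by (simp add: ring.ring_simprules[OF ring_Fq])

lift_definition plus_Fq_family :: "Fq_family \<Rightarrow> Fq_family \<Rightarrow> Fq_family"
  is "\<lambda>f g q N. f q N \<oplus>\<^bsub>Fq q N\<^esub> g q N"
  by (simp add: ring.ring_simprules[OF ring_Fq])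

lift_definition times_Fq_family :: "Fq_family \<Rightarrow> Fq_family \<Rightarrow> Fq_family"
  is "\<lambda>f g q N. f q N \<otimes>\<^bsub>Fq q N\<^esub> g q N"
  by (simp add: ring.ring_simprules[OF ring_Fq])

lift_definition uminus_Fq_family :: "Fq_family \<Rightarrow> Fq_family"
  is "\<lambda>f q N. \<ominus>\<^bsub>Fq q N\<^esub> f q N"
  by (simp add: ring.ring_simprules[OF ring_Fq])

lift_definition minus_Fq_family :: "Fq_family \<Rightarrow> Fq_family \<Rightarrow> Fq_family"
  is "\<lambda>f g q N. f q N \<ominus>\<^bsub>Fq q N\<^esub> g q N"
  by (simp add: ring.ring_simprules[OF ring_Fq])

instance
proof
  note ring = ring.ring_simprules[OF ring_Fq]
  fix a b c :: Fq_family
  show "a + b + c = a + (b + c)" by transfer (simp add: fun_eq_iff ring(7))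
  show "a + b = b + a" by transfer (simp add: fun_eq_iff ring(10))
  show "0 + a = a" by transfer (simp add: fun_eq_iff ring(8))
  show "- a + a = 0" by transfer (simp add: fun_eq_iff ring(9))
  show "a - b = a + - b" by transfer (simp add: fun_eq_iff a_minus_def)
  show "a * b * c = a * (b * c)" by transfer (simp add: fun_eq_iff ring(11))
  show "(a + b) * c = a * c + b * c" by transfer (simp add: fun_eq_iff ring(13))
  show "a * (b + c) = a * b + a * c" by transfer (simp add: fun_eq_iff ring(23))
  show "1 * a = a" by transfer (simp add: fun_eq_iff ring(12))
  show "a * 1 = a" by transfer (simp add: fun_eq_iff monoid.r_one[OF ring.is_monoid[OF ring_Fq]])
qed

end

lemmas component_simps = zero_Fq_family.rep_eq one_Fq_family.rep_eq plus_Fq_family.rep_eq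
  times_Fq_family.rep_eq

lemma component_closed: "component x q N \<in> carrier (Fq q N)"
  using component[of x] by simp

lemma Fq_family_eqI: "(\<And>q N. component x q N = component y q N) \<Longrightarrow> x = y"
  by (intro component_inject[THEN iffD1] ext)

lemma component_power: "component (x ^ k) q N = component x q N [^]\<^bsub>Fq q N\<^esub> k"
proof (induction k)
  case (Suc k)
  show ?case
    by (subst power_Suc2) (simp add: component_simps Suc)
qed (simp add: component_simps)

lemma component_sum:
  assumes "finite A"
  shows "component (sum f A) q N = (\<Oplus>\<^bsub>Fq q N\<^esub>i\<in>A. component (f i) q N)"
  using assms
proof (induction A rule: finite_induct)
  case empty
  then show ?case
    by (simp add: component_simps abelian_monoid.finsum_empty
        abelian_group.axioms(1)[OF ring.is_abelian_group[OF ring_Fq]])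
next
  case (insert i A)
  then show ?case
    by (simp add: component_simps abelian_monoid.finsum_insert component_closed
        abelian_group.axioms(1)[OF ring.is_abelian_group[OF ring_Fq]])
qed

text \<open>Being zero in all other components, embedded generators satisfy the relations there
  trivially; only the component at (q, N) has to be checked.\<close>

lift_definition embed :: "complex \<Rightarrow> nat \<Rightarrow> (letter word \<Rightarrow>\<^sub>0 complex) set \<Rightarrow> Fq_family" is
  "\<lambda>q N x q' N'. if q' = q \<and> N' = N \<and> x \<in> carrier (Fq q N) then x else \<zero>\<^bsub>Fq q' N'\<^esub>"
  by (simp add: ring.ring_simprules[OF ring_Fq])

text \<open>Scalars, unlike generators, must live in all components at once, since the scalar 1 has
  to act as the identity on the whole product.\<close>

lift_definition scal_family :: "complex \<Rightarrow> Fq_family" is "\<lambda>c q N. Fq_class q N (scal c)"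
  by (simp add: Fq_class_closed scal_in_carrier)

definition scale_family :: "complex \<Rightarrow> Fq_family \<Rightarrow> Fq_family" where
  "scale_family c x = scal_family c * x"

lemma component_scale:
  "component (scale_family c x) q N = Fq_class q N (scal c) \<otimes>\<^bsub>Fq q N\<^esub> component x q N"
  by (simp add: scale_family_def component_simps scal_family.rep_eq)

lemma scal_family_commute: "scal_family c * x = x * scal_family c"
proof (rule Fq_family_eqI)
  fix q N
  obtain p where p: "p \<in> carrier (FA N)" "component x q N = Fq_class q N p"
    using Fq_class_surj[OF component_closed] by blast
  then show "component (scal_family c * x) q N = component (x * scal_family c) q N"
    using scal_mult_commute[of c p]
    by (simp add: component_simps scal_family.rep_eq scal_in_carrier flip: Fq_class_mult)
qed

lemma scal_family_simps:
  "scal_family (a + b) = scal_family a + scal_family b"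
  "scal_family (a * b) = scal_family a * scal_family b"
  "scal_family 1 = 1"
  by (rule Fq_family_eqI; simp add: component_simps scal_family.rep_eq scal_simps scal_in_carrier
      Fq_class_add Fq_class_mult Fq_class_one)+

lemma vector_space_family: "vector_space scale_family"
  by standard (simp_all add: scale_family_def scal_family_simps distrib_left distrib_right mult.assoc)

definition Zf :: "complex \<Rightarrow> nat \<Rightarrow> nat \<Rightarrow> Fq_family" where
  "Zf q N i = embed q N (z q N i)"

definition Sf :: "complex \<Rightarrow> nat \<Rightarrow> nat \<Rightarrow> Fq_family" where
  "Sf q N i = embed q N (zstar q N i)"

lemma gens_in_carrier:
  "i < N \<Longrightarrow> gen (Z i) \<in> carrier (FA N)" "i < N \<Longrightarrow> gen (Zs i) \<in> carrier (FA N)"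
  by (auto intro!: gen_in_carrier simp: Fq_letters_def)

lemma component_Zf_Sf:
  "i < N \<Longrightarrow> component (Zf q N i) q' N' = (if q' = q \<and> N' = N then Fq_class q N (gen (Z i)) else \<zero>\<^bsub>Fq q' N'\<^esub>)"
  "i < N \<Longrightarrow> component (Sf q N i) q' N' = (if q' = q \<and> N' = N then Fq_class q N (gen (Zs i)) else \<zero>\<^bsub>Fq q' N'\<^esub>)"
  by (auto simp: Zf_def Sf_def embed.rep_eq z_def zstar_def Fq_class_closed gens_in_carrier)

lemmas FA_closed = free_algebra_closed scal_in_carrier gens_in_carrier

abbreviation "Fq_Z q N i \<equiv> Fq_class q N (gen (Z i))"
abbreviation "Fq_S q N i \<equiv> Fq_class q N (gen (Zs i))"

lemma Fq_relations:
  "i < j \<Longrightarrow> j < N \<Longrightarrow> Fq_Z q N i \<otimes>\<^bsub>Fq q N\<^esub> Fq_Z q N j =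
    Fq_class q N (scal (inverse q)) \<otimes>\<^bsub>Fq q N\<^esub> (Fq_Z q N j \<otimes>\<^bsub>Fq q N\<^esub> Fq_Z q N i)" (is "_ \<Longrightarrow> _ \<Longrightarrow> ?ZZ")
  "i < j \<Longrightarrow> j < N \<Longrightarrow> Fq_S q N i \<otimes>\<^bsub>Fq q N\<^esub> Fq_S q N j =
    Fq_class q N (scal q) \<otimes>\<^bsub>Fq q N\<^esub> (Fq_S q N j \<otimes>\<^bsub>Fq q N\<^esub> Fq_S q N i)" (is "_ \<Longrightarrow> _ \<Longrightarrow> ?SS")
  "i < N \<Longrightarrow> j < N \<Longrightarrow> i \<noteq> j \<Longrightarrow> Fq_Z q N i \<otimes>\<^bsub>Fq q N\<^esub> Fq_S q N j =
    Fq_class q N (scal (inverse q)) \<otimes>\<^bsub>Fq q N\<^esub> (Fq_S q N j \<otimes>\<^bsub>Fq q N\<^esub> Fq_Z q N i)" (is "_ \<Longrightarrow> _ \<Longrightarrow> _ \<Longrightarrow> ?ZS")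
  "i < N \<Longrightarrow> Fq_Z q N i \<otimes>\<^bsub>Fq q N\<^esub> Fq_S q N i = Fq_S q N i \<otimes>\<^bsub>Fq q N\<^esub> Fq_Z q N i \<oplus>\<^bsub>Fq q N\<^esub>
    Fq_class q N (scal (q\<^sup>2 - 1)) \<otimes>\<^bsub>Fq q N\<^esub> Fq_class q N (\<Sum>k\<in>{i<..<N}. gen (Z k) * gen (Zs k))" (is "_ \<Longrightarrow> ?same")
proof -
  show ?ZZ if "i < j" "j < N"
  proof -
    have "gen (Z i) * gen (Z j) - scal (inverse q) * (gen (Z j) * gen (Z i)) \<in> Fq_relators q N"
      unfolding Fq_relators_def mult.assoc[symmetric] using that by blast
    then have "Fq_class q N (gen (Z i) * gen (Z j)) = Fq_class q N (scal (inverse q) * (gen (Z j) * gen (Z i)))"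
      using that by (intro Fq_class_eqI FA_closed) auto
    then show ?thesis
      using that by (simp add: Fq_class_mult FA_closed)
  qed
  show ?SS if "i < j" "j < N"
  proof -
    have "gen (Zs i) * gen (Zs j) - scal q * (gen (Zs j) * gen (Zs i)) \<in> Fq_relators q N"
      unfolding Fq_relators_def mult.assoc[symmetric] using that by blast
    then have "Fq_class q N (gen (Zs i) * gen (Zs j)) = Fq_class q N (scal q * (gen (Zs j) * gen (Zs i)))"
      using that by (intro Fq_class_eqI FA_closed) auto
    then show ?thesis
      using that by (simp add: Fq_class_mult FA_closed)
  qed
  show ?ZS if "i < N" "j < N" "i \<noteq> j"
  proof -
    have "gen (Z i) * gen (Zs j) - scal (inverse q) * (gen (Zs j) * gen (Z i)) \<in> Fq_relators q N"
      unfolding Fq_relators_def mult.assoc[symmetric] using that by blast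
    then have "Fq_class q N (gen (Z i) * gen (Zs j)) = Fq_class q N (scal (inverse q) * (gen (Zs j) * gen (Z i)))"
      using that by (intro Fq_class_eqI FA_closed) auto
    then show ?thesis
      using that by (simp add: Fq_class_mult FA_closed)
  qed
  show ?same if "i < N"
  proof -
    let ?sum = "\<Sum>k\<in>{i<..<N}. gen (Z k) * gen (Zs k)"
    have c: "?sum \<in> carrier (FA N)"
      by (intro FA_closed) auto
    have "gen (Z i) * gen (Zs i) - (gen (Zs i) * gen (Z i) + scal (q\<^sup>2 - 1) * ?sum) \<in> Fq_relators q N"
      unfolding Fq_relators_def diff_diff_eq[symmetric] using that by blast
    then have "Fq_class q N (gen (Z i) * gen (Zs i)) =
        Fq_class q N (gen (Zs i) * gen (Z i) + scal (q\<^sup>2 - 1) * ?sum)"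
      using that c by (intro Fq_class_eqI free_algebra_add_closed FA_closed(1,4,5,6)) auto
    then show ?thesis
      using that c by (simp add: Fq_class_add Fq_class_mult FA_closed)
  qed
qed

lemma q_sphere_family:
  assumes "q \<noteq> 0"
  shows "q_sphere scale_family q N (Zf q N) (Sf q N)"
proof -
  interpret q_algebra scale_family q
    by (intro q_algebra.intro q_algebra_axioms.intro vector_space_family assms)
      (simp_all add: scale_family_def mult.assoc scal_family_commute[symmetric] flip: mult.assoc)
  note ring = ring.ring_simprules(2,5,8,15,24,25)[OF ring_Fq] Fq_class_closed scal_in_carrier
  note component = component_simps component_scale component_Zf_Sf
  have sum: "component (\<Sum>k\<in>K. Zf q N k * Sf q N k) q' N' =
      (if q' = q \<and> N' = N then Fq_class q N (\<Sum>k\<in>K. gen (Z k) * gen (Zs k)) else \<zero>\<^bsub>Fq q' N'\<^esub>)"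
    if "K \<subseteq> {..<N}" for K q' N'
    using finite_subset[OF that finite_lessThan] that
  proof (induction K rule: finite_induct)
    case (insert k K)
    have "(\<Sum>k\<in>K. gen (Z k) * gen (Zs k)) \<in> carrier (FA N)"
      using insert.prems by (intro FA_closed) auto
    then show ?case
      using insert by (simp add: component FA_closed Fq_class_add Fq_class_mult ring)
  qed (simp add: component Fq_class_zero)
  show ?thesis
  proof
    fix i j :: nat assume ij: "i < j" "j < N"
    show "qc (- 1) (Zf q N i) (Zf q N j)"
      unfolding qc_def
      by (rule Fq_family_eqI) (use ij Fq_relations(1)[OF ij, of q] in \<open>simp add: component ring power_int_minus\<close>)
    show "qc 1 (Sf q N i) (Sf q N j)"
      unfolding qc_def
      by (rule Fq_family_eqI) (use ij Fq_relations(2)[OF ij, of q] in \<open>simp add: component ring\<close>)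
  next
    fix i j :: nat assume ij: "i < N" "j < N" "i \<noteq> j"
    show "qc (- 1) (Zf q N i) (Sf q N j)"
      unfolding qc_def
      by (rule Fq_family_eqI) (use ij Fq_relations(3)[OF ij, of q] in \<open>simp add: component ring power_int_minus\<close>)
  next
    fix i assume i: "i < N"
    have K: "{i<..<N} \<subseteq> {..<N}" by auto
    have "Zf q N i * Sf q N i = Sf q N i * Zf q N i + scale_family (q\<^sup>2 - 1) (\<Sum>k\<in>{i<..<N}. Zf q N k * Sf q N k)"
      by (rule Fq_family_eqI) (use i Fq_relations(4)[OF i, of q] in \<open>simp add: component ring sum[OF K]\<close>)
    then show "Zf q N i * Sf q N i - Sf q N i * Zf q N i =
        scale_family (q\<^sup>2 - 1) (\<Sum>k\<in>{i<..<N}. Zf q N k * Sf q N k)"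
      by simp
  qed
qed

section \<open>The transposed action of the free algebra\<close>

primrec opL :: "complex \<Rightarrow> nat \<Rightarrow> letter \<Rightarrow> coeffs \<Rightarrow> coeffs" where
  "opL q N (Z j) = opZ q N j"
| "opL q N (Zs j) = opS q N j"

text \<open>\<open>fold\<close> applies the operator of the first letter first, as transposes of
  left multiplications require.\<close>

definition rep :: "complex \<Rightarrow> nat \<Rightarrow> (letter word \<Rightarrow>\<^sub>0 complex) \<Rightarrow> coeffs \<Rightarrow> coeffs" where
  "rep q N p h n d =
    (\<Sum>w\<in>Poly_Mapping.keys p. Poly_Mapping.lookup p w * fold (opL q N) (letters w) h n d)"

lemma rep_superset:
  assumes "finite A" "Poly_Mapping.keys p \<subseteq> A"
  shows "rep q N p h n d = (\<Sum>w\<in>A. Poly_Mapping.lookup p w * fold (opL q N) (letters w) h n d)"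
  unfolding rep_def using assms by (intro sum.mono_neutral_left) (auto simp: in_keys_iff)

lemma rep_add: "rep q N (p + r) h n d = rep q N p h n d + rep q N r h n d"
proof -
  let ?A = "Poly_Mapping.keys p \<union> Poly_Mapping.keys r"
  show ?thesis
    using keys_add[of p r]
    by (simp add: rep_superset[of ?A] lookup_add distrib_right sum.distrib)
qed

lemma rep_zero: "rep q N 0 h n d = 0"
  by (simp add: rep_def)

lemma rep_single: "rep q N (Poly_Mapping.single w c) h n d = c * fold (opL q N) (letters w) h n d"
  by (subst rep_superset[of "{w}"]) (auto simp: lookup_single)

lemma rep_uminus: "rep q N (- p) h n d = - rep q N p h n d"
  using rep_add[of q N p "- p" h n d] by (simp add: rep_zero add_eq_0_iff)

lemma rep_diff: "rep q N (p - r) h n d = rep q N p h n d - rep q N r h n d"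
  using rep_add[of q N p "- r" h n d] by (simp add: rep_uminus)

lemma rep_sum: "rep q N (sum f A) h n d = (\<Sum>i\<in>A. rep q N (f i) h n d)"
  by (induction A rule: infinite_finite_induct) (auto simp: rep_zero rep_add)

lemma fold_opL_linear:
  "fold (opL q N) xs (\<lambda>n d. a * f n d + b * g n d) =
    (\<lambda>n d. a * fold (opL q N) xs f n d + b * fold (opL q N) xs g n d)"
proof (induction xs arbitrary: f g)
  case (Cons x xs)
  then show ?case by (cases x) (simp_all add: op_linear)
qed simp

lemma rep_linear:
  "rep q N p (\<lambda>n d. a * f n d + b * g n d) n d = a * rep q N p f n d + b * rep q N p g n d"
  by (simp add: rep_def fold_opL_linear sum_distrib_left sum.distrib[symmetric] algebra_simps)

text \<open>An antihomomorphism. By additivity in both factors it suffices to take two monomials,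
  where concatenation of words becomes composition of folds.\<close>

lemma rep_mult: "rep q N (p * r) h n d = rep q N r (rep q N p h) n d"
proof (induction p rule: poly_mapping_induct)
  case zero
  show ?case
    using rep_linear[of q N r 0 h 0 h n d] by (simp add: rep_zero)
next
  case (single_add w c p)
  have "rep q N (Poly_Mapping.single w c * r) h n d = rep q N r (rep q N (Poly_Mapping.single w c) h) n d"
  proof (induction r rule: poly_mapping_induct)
    case (single_add v e r)
    have "rep q N (Poly_Mapping.single w c * Poly_Mapping.single v e) h n d =
        e * fold (opL q N) (letters v) (\<lambda>n d. c * fold (opL q N) (letters w) h n d) n d"
      using fold_opL_linear[of q N "letters v" c _ 0]
      by (simp add: mult_single rep_single plus_word_def)
    then show ?case
      using single_add by (simp add: distrib_left rep_add rep_single)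
  qed (simp add: rep_zero)
  moreover have "rep q N (Poly_Mapping.single w c + p) h =
      (\<lambda>n d. 1 * rep q N (Poly_Mapping.single w c) h n d + 1 * rep q N p h n d)"
    by (simp add: fun_eq_iff rep_add)
  ultimately show ?case
    unfolding distrib_right using single_add rep_linear[of q N r 1 _ 1] by (simp add: rep_add)
qed

lemma rep_gen: "rep q N (gen (Z i)) h = opZ q N i h" "rep q N (gen (Zs i)) h = opS q N i h"
  by (auto simp: fun_eq_iff gen_def rep_single)

lemma rep_scal_mult: "rep q N (scal c * p) h n d = c * rep q N p h n d"
proof -
  have "rep q N (scal c) h = (\<lambda>n d. c * h n d + 0 * h n d)" for h
    by (simp add: fun_eq_iff scal_def rep_single zero_word_def)
  then show ?thesis
    unfolding rep_mult using rep_linear[of q N p c h 0 h n d] by simp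
qed

lemma rep_relator:
  assumes "q \<noteq> 0" "r \<in> Fq_relators q N"
  shows "rep q N r h n d = 0"
  using assms(2) unfolding Fq_relators_def mult.assoc
proof (elim UnE CollectE exE conjE; hypsubst_thin)
  fix i j :: nat assume "i < j" "j < N"
  with assms(1) show "rep q N (gen (Z i) * gen (Z j) - scal (inverse q) * (gen (Z j) * gen (Z i))) h n d = 0"
    by (simp only: rep_diff rep_scal_mult, simp only: rep_mult rep_gen opZ_opZ) (simp add: field_simps)
next
  fix i j :: nat assume "i < j" "j < N"
  with assms(1) show "rep q N (gen (Zs i) * gen (Zs j) - scal q * (gen (Zs j) * gen (Zs i))) h n d = 0"
    by (simp only: rep_diff rep_scal_mult, simp only: rep_mult rep_gen opS_opS) simp
next
  fix i j :: nat assume "i < N" "j < N" "i \<noteq> j"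
  then have "opS q N j (opZ q N i h) n d = opZ q N i (opS q N j h) n d / q"
    using opS_opZ_less[OF assms(1)] opS_opZ_greater[OF assms(1)] by (meson linorder_neqE_nat)
  then show "rep q N (gen (Z i) * gen (Zs j) - scal (inverse q) * (gen (Zs j) * gen (Z i))) h n d = 0"
    by (simp only: rep_diff rep_scal_mult, simp only: rep_mult rep_gen) (simp add: field_simps)
next
  fix i :: nat assume "i < N"
  then show "rep q N (gen (Z i) * gen (Zs i) - gen (Zs i) * gen (Z i)
      - scal (q\<^sup>2 - 1) * (\<Sum>k\<in>{i<..<N}. gen (Z k) * gen (Zs k))) h n d = 0"
    using opS_opZ_diff[OF assms(1), of i N h n d]
    by (simp only: rep_diff rep_scal_mult, simp only: rep_sum rep_mult rep_gen) simp
qed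

text \<open>The elements acting as zero on all functions form a two-sided ideal, which contains the
  relators and hence the ideal they generate.\<close>

lemma rep_ideal:
  assumes "q \<noteq> 0" "p \<in> Fq_ideal q N"
  shows "rep q N p h n d = 0"
proof -
  let ?J = "{p \<in> carrier (FA N). \<forall>h n d. rep q N p h n d = 0}"
  interpret R: ring "FA N" by (rule ring_free_algebra)
  have "ideal ?J (FA N)"
  proof (rule idealI[OF ring_free_algebra])
    show "subgroup ?J (add_monoid (FA N))"
    proof (rule R.add.subgroupI)
      show "?J \<noteq> {}"
        using R.zero_closed by (auto simp: free_algebra_simps rep_zero)
      show "\<ominus>\<^bsub>FA N\<^esub> p \<in> ?J" if "p \<in> ?J" for p
        using that R.a_inv_closed[of p] by (simp add: free_algebra_a_inv rep_uminus)
      show "p \<oplus>\<^bsub>FA N\<^esub> r \<in> ?J" if "p \<in> ?J" "r \<in> ?J" for p r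
        using that R.a_closed[of p r] by (simp add: free_algebra_simps rep_add)
    qed auto
    fix p r assume p: "p \<in> ?J" and r: "r \<in> carrier (FA N)"
    have "rep q N p h = (\<lambda>n d. 0 * h n d + 0 * h n d)" for h
      using p by (simp add: fun_eq_iff)
    then have "rep q N r (rep q N p h) n d = 0" for h n d
      using rep_linear[of q N r 0 h 0 h n d] by simp
    then show "p \<otimes>\<^bsub>FA N\<^esub> r \<in> ?J" "r \<otimes>\<^bsub>FA N\<^esub> p \<in> ?J"
      using p r by (simp_all add: free_algebra_simps rep_mult free_algebra_closed)
  qed
  moreover have "Fq_relators q N \<subseteq> ?J"
    using rep_relator[OF assms(1)] Fq_relators_in_carrier[of q N] by blast
  ultimately have "Fq_ideal q N \<subseteq> ?J"
    unfolding Fq_ideal_def by (rule R.genideal_minimal)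
  then show ?thesis using assms(2) by auto
qed

text \<open>The representative is arbitrary; for nonzero q any other one gives the same value,
  because the ideal acts as zero. Evaluation at (0,0) reflects E(0,0) = 1.\<close>

definition Kf :: "complex \<Rightarrow> nat \<Rightarrow> Fq_family \<Rightarrow> coeffs \<Rightarrow> complex" where
  "Kf q N x h = rep q N (SOME p. p \<in> carrier (FA N) \<and> component x q N = Fq_class q N p) h (\<lambda>_. 0) (\<lambda>_. 0)"

lemma Kf_eq:
  assumes "q \<noteq> 0" "p \<in> carrier (FA N)" "component x q N = Fq_class q N p"
  shows "Kf q N x h = rep q N p h (\<lambda>_. 0) (\<lambda>_. 0)"
proof -
  let ?p = "SOME p. p \<in> carrier (FA N) \<and> component x q N = Fq_class q N p"
  have "?p \<in> carrier (FA N) \<and> component x q N = Fq_class q N ?p"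
    by (rule someI[of _ p]) (use assms in simp)
  then have "?p - p \<in> Fq_ideal q N"
    using assms Fq_class_eq_iff[of ?p N p q] by simp
  then have "rep q N (?p - p) h (\<lambda>_. 0) (\<lambda>_. 0) = 0"
    by (rule rep_ideal[OF assms(1)])
  then show ?thesis
    by (simp add: Kf_def rep_diff)
qed

lemma component_obtain:
  obtains p where "p \<in> carrier (FA N)" "component x q N = Fq_class q N p"
  using Fq_class_surj[OF component_closed] by blast

lemma q_sphere_functional_family:
  assumes "q \<noteq> 0"
  shows "q_sphere_functional scale_family q N (Zf q N) (Sf q N) (Kf q N)"
proof -
  interpret q_sphere scale_family q N "Zf q N" "Sf q N"
    by (rule q_sphere_family[OF assms])
  note Kf = Kf_eq[OF assms]
  show ?thesis
  proof
    fix x y :: Fq_family and h f g :: coeffs and c :: complex and j :: nat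
    obtain p r where p: "p \<in> carrier (FA N)" "component x q N = Fq_class q N p"
      and r: "r \<in> carrier (FA N)" "component y q N = Fq_class q N r"
      using component_obtain by metis
    have "component (x + y) q N = Fq_class q N (p + r)"
      using p r by (simp add: component_simps Fq_class_add)
    then show "Kf q N (x + y) h = Kf q N x h + Kf q N y h"
      using p r by (simp add: Kf[OF p] Kf[OF r] Kf[of "p + r"] free_algebra_add_closed rep_add)
    have "component (scale_family c x) q N = Fq_class q N (scal c * p)"
      using p by (simp add: component_scale Fq_class_mult scal_in_carrier)
    then show "Kf q N (scale_family c x) h = c * Kf q N x h"
      using p by (simp add: Kf[OF p] Kf[of "scal c * p"] FA_closed rep_scal_mult)
    show "Kf q N x (\<lambda>n d. f n d + g n d) = Kf q N x f + Kf q N x g"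
      using rep_linear[of q N p 1 f 1 g] by (simp add: Kf[OF p])
    show "Kf q N (Zf q N j * x) h = Kf q N x (opZ q N j h)" if "j < N"
    proof -
      have "component (Zf q N j * x) q N = Fq_class q N (gen (Z j) * p)"
        using p that by (simp add: component_simps component_Zf_Sf Fq_class_mult FA_closed)
      then show ?thesis
        using p that by (simp add: Kf[OF p] Kf[of "gen (Z j) * p"] FA_closed rep_mult rep_gen)
    qed
    show "Kf q N (Sf q N j * x) h = Kf q N x (opS q N j h)" if "j < N"
    proof -
      have "component (Sf q N j * x) q N = Fq_class q N (gen (Zs j) * p)"
        using p that by (simp add: component_simps component_Zf_Sf Fq_class_mult FA_closed)
      then show ?thesis
        using p that by (simp add: Kf[OF p] Kf[of "gen (Zs j) * p"] FA_closed rep_mult rep_gen)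
    qed
    have "component 1 q N = Fq_class q N (scal 1)"
      by (simp add: component_simps scal_simps Fq_class_one)
    from Kf[OF scal_in_carrier this, of h] show "Kf q N 1 h = h (\<lambda>_. 0) (\<lambda>_. 0)"
      by (simp add: scal_def rep_single zero_word_def)
  qed
qed

section \<open>The center of F_q(N)\<close>

theorem proposition5p5:
  fixes q :: complex and m N :: nat
  assumes "N \<ge> 2"
    and "odd m"
    and "primitive_root_of_unity m q"
  shows "ring_center (Fq q N) =
    Fq_subalgebra_gen q N
      ({Omega q N}
       \<union> {z q N i [^]\<^bsub>Fq q N\<^esub> m | i. i < N}
       \<union> {zstar q N i [^]\<^bsub>Fq q N\<^esub> m | i. i < N}
       \<union> {z q N (N - 1) [^]\<^bsub>Fq q N\<^esub> a \<otimes>\<^bsub>Fq q N\<^esub> zstar q N (N - 1) [^]\<^bsub>Fq q N\<^esub> b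
            | a b. a \<in> {1..m - 1} \<and> b \<in> {1..m - 1} \<and> a + b = m})"
    (is "_ = Fq_subalgebra_gen q N ?H")
proof -
  have "q \<noteq> 0"
    using assms(3) by (auto simp: primitive_root_of_unity_def power_0_left)
  interpret q_sphere_functional scale_family q N "Zf q N" "Sf q N" "Kf q N"
    by (rule q_sphere_functional_family) fact
  interpret q_sphere_center scale_family q N "Zf q N" "Sf q N" m "Kf q N"
    by unfold_locales fact+
  interpret R: ring "Fq q N" by (rule ring_Fq)
  let ?R = "Fq q N"
  let ?cls = "Fq_class q N"
  define G where "G = generate_ring ?R (range (\<lambda>c. ?cls (scal c)) \<union> ?H)"
  have Z: "component (Zf q N i) q N = z q N i" and S: "component (Sf q N i) q N = zstar q N i"
    if "i < N" for i
    using that by (simp_all add: component_Zf_Sf z_def zstar_def)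
  have Omega: "component (Om 0) q N = Omega q N"
  proof -
    have "component (Om 0) q N = (\<Oplus>\<^bsub>?R\<^esub>k\<in>{..<N}. component (Zf q N k * Sf q N k) q N)"
      by (simp add: Om_def atLeast0LessThan component_sum)
    also have "\<dots> = Omega q N"
      unfolding Omega_def
    proof (rule R.finsum_cong'[OF refl])
      show "(\<lambda>k. z q N k \<otimes>\<^bsub>?R\<^esub> zstar q N k) \<in> {..<N} \<rightarrow> carrier ?R"
        by (auto simp: z_def zstar_def Fq_class_closed FA_closed)
    qed (simp add: component_simps Z S)
    finally show ?thesis .
  qed

  have scale_1: "component (scale_family c 1) q N = ?cls (scal c)" for c
    by (simp add: scale_family_def scal_family.rep_eq)
  \<comment> \<open>A word is its letters multiplied successively onto 1 from the left, and the span
    is stable under each such step.\<close>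
  have word_basis_span: "\<exists>Y\<in>basis_span. component Y q N = ?cls (Poly_Mapping.single (Word xs) c)"
    if "set xs \<subseteq> Fq_letters N" for xs c
    using that
  proof (induction xs)
    case Nil
    show ?case
      using basis_span_closed(4)[OF one_in_basis_span, of c]
      by (intro bexI[of _ "scale_family c 1"])
        (simp_all add: scale_1 scal_def zero_word_def)
  next
    case (Cons x xs)
    then obtain Y where Y: "Y \<in> basis_span" "component Y q N = ?cls (Poly_Mapping.single (Word xs) c)"
      by auto
    have eq: "Poly_Mapping.single (Word (x # xs)) c = gen x * Poly_Mapping.single (Word xs) c"
      by (simp add: gen_def mult_single plus_word_def)
    have car: "Poly_Mapping.single (Word xs) c \<in> carrier (FA N)"
      using Cons.prems by (simp add: free_algebra_def)
    obtain i where i: "i < N" "x = Z i \<or> x = Zs i"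
      using Cons.prems by (auto simp: Fq_letters_def)
    from i(2) show ?case
    proof
      assume x: "x = Z i"
      have "component (Zf q N i * Y) q N = ?cls (Poly_Mapping.single (Word (x # xs)) c)"
        unfolding eq by (simp add: component_simps component_Zf_Sf Y x i Fq_class_mult FA_closed car)
      then show ?case using Z_mult_basis_span[OF i(1) Y(1)] by blast
    next
      assume x: "x = Zs i"
      have "component (Sf q N i * Y) q N = ?cls (Poly_Mapping.single (Word (x # xs)) c)"
        unfolding eq by (simp add: component_simps component_Zf_Sf Y x i Fq_class_mult FA_closed car)
      then show ?case using S_mult_basis_span[OF i(1) Y(1)] by blast
    qed
  qed
  have class_basis_span: "\<exists>Y\<in>basis_span. component Y q N = ?cls p" if "p \<in> carrier (FA N)" for p
    using that
  proof (induction p rule: poly_mapping_induct)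
    case zero
    show ?case using basis_span_closed(1) by (intro bexI[of _ 0]) (simp_all add: component_simps Fq_class_zero)
  next
    case (single_add w c p)
    have "Poly_Mapping.keys (Poly_Mapping.single w c + p) = insert w (Poly_Mapping.keys p)"
      using single_add(1,2) by (auto simp: in_keys_iff lookup_add lookup_single when_def split: if_splits)
    with single_add.prems have car: "set (letters w) \<subseteq> Fq_letters N" "p \<in> carrier (FA N)"
      "Poly_Mapping.single w c \<in> carrier (FA N)"
      by (auto simp: free_algebra_def)
    obtain Y Y' where "Y \<in> basis_span" "component Y q N = ?cls p"
      "Y' \<in> basis_span" "component Y' q N = ?cls (Poly_Mapping.single w c)"
      using single_add.IH[OF car(2)] word_basis_span[OF car(1), of c] by auto
    then show ?case
      using car by (intro bexI[of _ "Y' + Y"]) (simp_all add: component_simps Fq_class_add basis_span_closed)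
  qed
  have carrier_basis_span: "\<exists>Y\<in>basis_span. component Y q N = x" if "x \<in> carrier ?R" for x
    using Fq_class_surj[OF that] class_basis_span by metis

  have center_eq: "component X q N \<in> ring_center ?R" if "central X" for X
    unfolding ring_center_def
  proof (intro CollectI conjI ballI)
    show "component X q N \<in> carrier ?R" by (rule component_closed)
    fix y assume "y \<in> carrier ?R"
    then obtain Y where "Y \<in> basis_span" "component Y q N = y" using carrier_basis_span by blast
    then show "component X q N \<otimes>\<^bsub>?R\<^esub> y = y \<otimes>\<^bsub>?R\<^esub> component X q N"
      using central_commutes_basis_span[OF that \<open>Y \<in> basis_span\<close>] by (metis times_Fq_family.rep_eq)
  qed

  have H_center: "h \<in> ring_center ?R" if h: "h \<in> range (\<lambda>c. ?cls (scal c)) \<union> ?H" for h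
  proof -
    have "\<exists>X. central X \<and> h = component X q N"
    proof -
      consider c where "h = ?cls (scal c)" | "h = Omega q N"
        | i where "i < N" "h = z q N i [^]\<^bsub>?R\<^esub> m" | i where "i < N" "h = zstar q N i [^]\<^bsub>?R\<^esub> m"
        | a b where "a + b = m" "h = z q N (N - 1) [^]\<^bsub>?R\<^esub> a \<otimes>\<^bsub>?R\<^esub> zstar q N (N - 1) [^]\<^bsub>?R\<^esub> b"
        using h by blast
      then show ?thesis
      proof cases
        case 1
        have "central (scale_family c 1)"
          using central_1 by (simp add: central_def qc_scale_right)
        then show ?thesis
          using 1 by (intro exI[of _ "scale_family c 1"])
            (simp add: scale_1)
      next
        case 2
        then show ?thesis using central_Om0 N_ge_2 Omega by (intro exI[of _ "Om 0"]) simp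
      next
        case (3 i)
        then show ?thesis using central_Z_power by (intro exI[of _ "Zf q N i ^ m"]) (simp add: component_power Z)
      next
        case (4 i)
        then show ?thesis using central_S_power by (intro exI[of _ "Sf q N i ^ m"]) (simp add: component_power S)
      next
        case (5 a b)
        then show ?thesis
          using central_Z_S_last[of a b] N_ge_2
          by (intro exI[of _ "Zf q N (N - 1) ^ a * Sf q N (N - 1) ^ b"])
            (simp add: component_simps component_power Z S)
      qed
    qed
    then show ?thesis using center_eq by blast
  qed

  have "x \<in> ring_center ?R" if "x \<in> G" for x
    using that unfolding G_def
  proof (induction rule: generate_ring.induct)
    case one
    then show ?case using center_eq[OF central_1] by (simp add: component_simps)
  next
    case (incl h)
    then show ?case by (rule H_center)
  next
    case (a_inv h)
    then show ?case by (simp add: ring_center_def R.l_minus R.r_minus)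
  next
    case (eng_add h1 h2)
    then show ?case by (simp add: ring_center_def R.l_distr R.r_distr)
  next
    case (eng_mult h1 h2)
    then have h: "h1 \<in> carrier ?R" "h2 \<in> carrier ?R"
      "\<And>y. y \<in> carrier ?R \<Longrightarrow> h1 \<otimes>\<^bsub>?R\<^esub> y = y \<otimes>\<^bsub>?R\<^esub> h1"
      "\<And>y. y \<in> carrier ?R \<Longrightarrow> h2 \<otimes>\<^bsub>?R\<^esub> y = y \<otimes>\<^bsub>?R\<^esub> h2"
      by (auto simp: ring_center_def)
    have "(h1 \<otimes>\<^bsub>?R\<^esub> h2) \<otimes>\<^bsub>?R\<^esub> y = y \<otimes>\<^bsub>?R\<^esub> (h1 \<otimes>\<^bsub>?R\<^esub> h2)" if y: "y \<in> carrier ?R" for y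
    proof -
      have "(h1 \<otimes>\<^bsub>?R\<^esub> h2) \<otimes>\<^bsub>?R\<^esub> y = (h1 \<otimes>\<^bsub>?R\<^esub> y) \<otimes>\<^bsub>?R\<^esub> h2"
        using h(1,2) y by (simp only: R.m_assoc h(4)[OF y])
      then show ?thesis
        using h(1,2) y by (simp only: h(3)[OF y] R.m_assoc)
    qed
    then show ?case using h(1,2) by (simp add: ring_center_def)
  qed
  moreover have "x \<in> G" if "x \<in> ring_center ?R" for x
  proof -
    have x: "x \<in> carrier ?R" "\<And>y. y \<in> carrier ?R \<Longrightarrow> x \<otimes>\<^bsub>?R\<^esub> y = y \<otimes>\<^bsub>?R\<^esub> x"
      using that by (auto simp: ring_center_def)
    obtain Y where Y: "Y \<in> basis_span" "component Y q N = x"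
      using carrier_basis_span[OF x(1)] by blast
    \<comment> \<open>Only the component of Y at (q, N) is known to be x; the others may be nonzero.
      They do no harm, because g vanishes there and both products are zero.\<close>
    have gen_Y: "g * Y = Y * g"
      if g: "\<And>q' N'. component g q' N' = (if q' = q \<and> N' = N then y else \<zero>\<^bsub>Fq q' N'\<^esub>)" for g y
    proof (rule Fq_family_eqI)
      fix q' N'
      have "y \<in> carrier ?R"
        using component_closed[of g q N] g[of q N] by simp
      then show "component (g * Y) q' N' = component (Y * g) q' N'"
        using x(2)[of y] Y(2) by (auto simp: component_simps g component_closed ring.ring_simprules(24,25)[OF ring_Fq])
    qed
    have "central Y"
      unfolding central_def qc_0_iff using gen_Y[OF component_Zf_Sf(1)] gen_Y[OF component_Zf_Sf(2)] by blast
    obtain T c where T: "finite T" "T \<subseteq> supported" "\<And>s. s \<in> T \<Longrightarrow> c s \<noteq> 0"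
      and Y_sum: "Y = (\<Sum>s\<in>T. scale_family (c s) (case_prod E s))"
      using basis_span_expansion[OF Y(1)] by metis
    \<comment> \<open>The preimage of the generated subring under one component; it inherits all
      closure properties needed for \<open>central_index_in_subalgebra\<close>.\<close>
    define B where "B = {X. component X q N \<in> G}"
    have add: "a + b \<in> B" if "a \<in> B" "b \<in> B" for a b
      using that unfolding B_def G_def mem_Collect_eq component_simps by (rule generate_ring.eng_add)
    have mult: "a * b \<in> B" if "a \<in> B" "b \<in> B" for a b
      using that unfolding B_def G_def mem_Collect_eq component_simps by (rule generate_ring.eng_mult)
    have one: "1 \<in> B"
      unfolding B_def G_def mem_Collect_eq component_simps by (rule generate_ring.one)
    have scalar: "scal_family k \<in> B" for k
      unfolding B_def G_def mem_Collect_eq scal_family.rep_eq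
      by (intro generate_ring.incl UnI1 rangeI)
    have scale: "scale_family k a \<in> B" if "a \<in> B" for k a
      unfolding scale_family_def by (rule mult[OF scalar that])
    have inc: "X \<in> B" if "component X q N \<in> ?H" for X
      unfolding B_def G_def mem_Collect_eq by (rule generate_ring.incl, rule UnI2, rule that)
    have "0 \<in> B"
      using scale[OF one, of 0] by simp
    then have sum_B: "sum f A \<in> B" if "\<And>s. s \<in> A \<Longrightarrow> f s \<in> B" for A and f :: "_ \<Rightarrow> Fq_family"
      using that by (induction A rule: infinite_finite_induct) (auto intro: add)
    have "E n d \<in> B" if "(n, d) \<in> T" for n d
    proof (rule central_index_in_subalgebra[OF one mult add scale])
      show "Om 0 \<in> B" by (rule inc) (simp add: Omega)
      show "Zf q N i ^ m \<in> B" if "i < N" for i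
        by (rule inc) (use that in \<open>auto simp: component_power Z\<close>)
      show "Sf q N i ^ m \<in> B" if "i < N" for i
        by (rule inc) (use that in \<open>auto simp: component_power S\<close>)
      show "Zf q N (N - 1) ^ a * Sf q N (N - 1) ^ b \<in> B"
        if "a \<in> {1..m - 1}" "b \<in> {1..m - 1}" "a + b = m" for a b
      proof -
        have "component (Zf q N (N - 1) ^ a * Sf q N (N - 1) ^ b) q N =
            z q N (N - 1) [^]\<^bsub>?R\<^esub> a \<otimes>\<^bsub>?R\<^esub> zstar q N (N - 1) [^]\<^bsub>?R\<^esub> b"
          using N_ge_2 by (simp add: component_simps component_power Z S)
        then show ?thesis
          using that by (intro inc) blast
      qed
      show "central_index n d"
        using central_imp_central_index[OF _ T that] \<open>central Y\<close> Y_sum by simp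
    qed
    then have "scale_family (c s) (case_prod E s) \<in> B" if "s \<in> T" for s
      using that scale by (cases s) auto
    then have "(\<Sum>s\<in>T. scale_family (c s) (case_prod E s)) \<in> B"
      by (rule sum_B)
    then show ?thesis
      using Y Y_sum by (simp add: B_def)
  qed
  ultimately show ?thesis
    unfolding Fq_subalgebra_gen_def G_def by blast
qed

end
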